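(* Let $\Lambda=A\cup B$ with $A\cap B=\varnothing$ be a finite bipartite lattice with $|\Lambda|$ even, carrying a spin-$\tfrac12$ at each site, let $H_{\mathrm{MLM}}=\boldsymbol{S}_A\cdot\boldsymbol{S}_B$ be the Marshall-Lieb-Mattis Hamiltonian, let $\mathfrak{H}_0=\ker(S^{(3)}_{\mathrm{tot}})$ be the $M=0$ subspace, and let $O=\boldsymbol{S}_{\mathrm{tot}}^2$ (restricted to $\mathfrak{H}_0$). Then every Hamiltonian $H$ in the stability class $\mathscr{U}_O(H_{\mathrm{MLM}}\restriction\mathfrak{H}_0)$ (with $\mathfrak{H}_*=\mathfrak{H}_0$) satisfies $\mu(H)=S_*(S_*+1)$, where $S_*=\big||A|-|B|\big|/2$.
   Context: Spins. At each site $x\in\Lambda$ there are spin-$\frac12$ operators $\boldsymbol{S}_x=(S_x^{(1)},S_x^{(2)},S_x^{(3)})$ acting on $\bigotimes_{x\in\Lambda}\mathbb{C}^2$ with $[S_x^{(j)},S_y^{(k)}]=i\delta_{xy}\sum_{\ell=1}^3\varepsilon_{jk\ell}S_x^{(\ell)}$. $\boldsymbol{S}_A=\sum_{x\in A}\boldsymbol{S}_x$, $\boldsymbol{S}_B=\sum_{x\in B}\boldsymbol{S}_x$, $\boldsymbol{S}_{\mathrm{tot}}=\sum_{x\in\Lambda}\boldsymbol{S}_x=(S^{(1)}_{\mathrm{tot}},S^{(2)}_{\mathrm{tot}},S^{(3)}_{\mathrm{tot}})$, $\boldsymbol{S}_{\mathrm{tot}}^2=\sum_{j=1}^3(S_{\mathrm{tot}}^{(j)})^2$.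 Cones. In a complex Hilbert space $\mathfrak{H}$, a convex cone is a closed convex set $\mathfrak{P}\subset\mathfrak{H}$ with $t\mathfrak{P}\subseteq\mathfrak{P}$ for all $t\ge0$ and $\mathfrak{P}\cap(-\mathfrak{P})=\{0\}$. It is self-dual if $\mathfrak{P}=\{\eta\in\mathfrak{H}: \langle\eta|\xi\rangle\ge0\ \forall\xi\in\mathfrak{P}\}$. A vector $\eta\in\mathfrak{P}$ is strictly positive ($\eta>0$ w.r.t. $\mathfrak{P}$) if $\langle\xi|\eta\rangle>0$ for all $\xi\in\mathfrak{P}\setminus\{0\}$. For bounded $A$: $A\unrhd0$ w.r.t. $\mathfrak{P}$ means $A\mathfrak{P}\subseteq\mathfrak{P}$; $A\rhd0$ w.r.t. $\mathfrak{P}$ means $A\xi>0$ w.r.t. $\mathfrak{P}$ for all $\xi\in\mathfrak{P}\setminus\{0\}$. For a self-dual cone $\mathfrak{P}$ in $\mathfrak{H}$, $\mathscr{A}^+_{\mathfrak{P}}$ is the set of self-adjoint operators $H$ on $\mathfrak{H}$ that are bounded from below, have purely discrete spectrum (empty essential spectrum), and satisfy $(H+s)^{-1}\rhd0$ w.r.t. $\mathfrak{P}$ for all $s>-E(H)$, where $E(H)=\inf\mathrm{spec}(H)$. If $H\in\mathscr{A}^+_{\mathfrak{P}}$ then $E(H)$ is a simple eigenvalue with a strictly positive eigenvector, denoted $\psi_H$. Inheritance. Let $\mathfrak{H}_1$ be a closed subspace of $\mathfrak{H}_2$, $\pi_{1,2}$ the orthogonal projection of $\mathfrak{H}_2$ onto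 $\mathfrak{H}_1$, and $\mathfrak{P}_j\subset\mathfrak{H}_j$ self-dual cones. Write $\mathfrak{P}_1\dashrightarrow\mathfrak{P}_2$ if $\mathfrak{P}_1=\pi_{1,2}\mathfrak{P}_2$ and $\pi_{1,2}\unrhd0$ w.r.t. $\mathfrak{P}_2$. For $H_j\in\mathscr{A}^+_{\mathfrak{P}_j}$ write $(H_1,\mathfrak{P}_1)\to(H_2,\mathfrak{P}_2)$ if $\mathfrak{P}_1\dashrightarrow\mathfrak{P}_2$. The class. For a Hilbert space $\mathfrak{H}_*$ and a bounded self-adjoint $O$ on it with purely discrete spectrum, $\mathbb{H}_{\mathfrak{H}_*}$ is the collection of all Hilbert spaces containing $\mathfrak{H}_*$ as a closed subspace. $O$ is extended to each $\mathfrak{H}\in\mathbb{H}_{\mathfrak{H}_*}$ as $O\oplus0$ on $\mathfrak{H}_*\oplus\mathfrak{H}_*^\perp$, again denoted $O$. $\mathscr{P}_{\mathfrak{H}_*,0}=\bigcup_{\mathfrak{H}\in\mathbb{H}_{\mathfrak{H}_*}}\bigcup_{\mathfrak{P}\subset\mathfrak{H}\text{ self-dual cone}}\mathscr{A}^+_{\mathfrak{P}}$, and $\mathscr{P}_{\mathfrak{H}_*,0}(O)$ is the set of $H\in\mathscr{P}_{\mathfrak{H}_*,0}$ with $e^{isO}e^{itH}=e^{itH}e^{isO}$ for all $s,t\in\mathbb{R}$. The order. For $H,K\in\mathscr{P}_{\mathfrak{H}_*,0}(O)$, write $H\to K$ if there are $N\ge2$, Hilbert spaces $\mathfrak{H}_1\subseteq\dots\subseteq\mathfrak{H}_N$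 in $\mathbb{H}_{\mathfrak{H}_*}$ (each a closed subspace of the next), operators $H_j\in\mathscr{P}_{\mathfrak{H}_*,0}(O)$ acting in $\mathfrak{H}_j$ with $H_1=H$, $H_N=K$, and self-dual cones $\mathfrak{P}_j\subset\mathfrak{H}_j$ ($1\le j\le N-1$), $\mathfrak{P}_j'\subset\mathfrak{H}_j$ ($2\le j\le N$) such that $(H_j,\mathfrak{P}_j)\to(H_{j+1},\mathfrak{P}_{j+1}')$ for $j=1,\dots,N-1$. This is a preorder; $H\equiv K$ means $H\to K$ and $K\to H$; $\mathscr{P}_{\mathfrak{H}_*}(O)=\mathscr{P}_{\mathfrak{H}_*,0}(O)/\equiv$ with the induced partial order $\to$, and a class $[H]$ is identified with its representative $H$. Stability class: $\mathscr{U}_O(H_* )=\{H\in\mathscr{P}_{\mathfrak{H}_*}(O): H_*\to H\}$. Good quantum number: since $E(H)$ is simple and $H$ commutes strongly with $O$, $\psi_H$ is an eigenvector of $O$, and $\mu(H)$ is defined by $O\psi_H=\mu(H)\psi_H$. *)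

theory Defs
  imports "HOL-Analysis.Analysis" "HOL-Library.Complex_Order"
begin

section \<open>Complex Hilbert spaces\<close>

text \<open>
  The inner product \<^term>\<open>cinner\<close> is linear in its second argument.  The norm is the one of
  \<^class>\<open>real_inner\<close>, so positive definiteness is inherited from there.  The order on
  \<^typ>\<open>complex\<close> is the one of \<^theory>\<open>HOL-Library.Complex_Order\<close>:
  \<open>0 \<le> z\<close> says that \<open>z\<close> is real and nonnegative.
\<close>

class chilbert_space = real_inner + complete_space +
  fixes scaleC :: "complex \<Rightarrow> 'a \<Rightarrow> 'a"  (infixr "*\<^sub>C" 75)
    and cinner :: "'a \<Rightarrow> 'a \<Rightarrow> complex"
  assumes scaleC_add_right: "c *\<^sub>C (x + y) = c *\<^sub>C x + c *\<^sub>C y"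
    and scaleC_add_left: "(c + d) *\<^sub>C x = c *\<^sub>C x + d *\<^sub>C x"
    and scaleC_scaleC: "c *\<^sub>C d *\<^sub>C x = (c * d) *\<^sub>C x"
    and scaleC_of_real: "complex_of_real r *\<^sub>C x = r *\<^sub>R x"
    and cinner_commute: "cinner x y = cnj (cinner y x)"
    and cinner_add_right: "cinner x (y + z) = cinner x y + cinner x z"
    and cinner_scaleC_right: "cinner x (c *\<^sub>C y) = c * cinner x y"
    and inner_eq_Re_cinner: "inner x y = Re (cinner x y)"

instantiation complex :: chilbert_space
begin

definition scaleC_complex :: "complex \<Rightarrow> complex \<Rightarrow> complex" where
  "scaleC_complex c z = c * z"

definition cinner_complex :: "complex \<Rightarrow> complex \<Rightarrow> complex" where
  "cinner_complex z w = cnj z * w"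

instance
  by standard
    (auto simp: scaleC_complex_def cinner_complex_def algebra_simps scaleR_conv_of_real
      inner_complex_def)

end

instantiation vec :: (chilbert_space, finite) chilbert_space
begin

definition scaleC_vec :: "complex \<Rightarrow> 'a ^ 'b \<Rightarrow> 'a ^ 'b" where
  "scaleC_vec c v = (\<chi> i. c *\<^sub>C (v $ i))"

definition cinner_vec :: "'a ^ 'b \<Rightarrow> 'a ^ 'b \<Rightarrow> complex" where
  "cinner_vec v w = (\<Sum>i\<in>UNIV. cinner (v $ i) (w $ i))"

instance
proof
  fix x y :: "'a ^ 'b"
  show "cinner x y = cnj (cinner y x)"
    unfolding cinner_vec_def cnj_sum by (rule sum.cong[OF refl], rule cinner_commute)
qed (auto simp: scaleC_vec_def cinner_vec_def vec_eq_iff scaleC_add_right scaleC_add_left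
      scaleC_scaleC scaleC_of_real cinner_add_right cinner_scaleC_right sum.distrib
      sum_distrib_left inner_vec_def inner_eq_Re_cinner)

end

definition csubspace :: "'h::chilbert_space set \<Rightarrow> bool" where
  "csubspace M \<longleftrightarrow> 0 \<in> M \<and> (\<forall>x\<in>M. \<forall>y\<in>M. x + y \<in> M) \<and> (\<forall>c. \<forall>x\<in>M. c *\<^sub>C x \<in> M)"

definition closed_csubspace :: "'h::chilbert_space set \<Rightarrow> bool" where
  "closed_csubspace M \<longleftrightarrow> csubspace M \<and> closed M"

definition clinear_on :: "'a::chilbert_space set \<Rightarrow> ('a \<Rightarrow> 'b::chilbert_space) \<Rightarrow> bool" where
  "clinear_on M f \<longleftrightarrow> (\<forall>x\<in>M. \<forall>y\<in>M. f (x + y) = f x + f y) \<and> (\<forall>c. \<forall>x\<in>M. f (c *\<^sub>C x) = c *\<^sub>C f x)"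

definition isometric_on :: "'a::chilbert_space set \<Rightarrow> ('a \<Rightarrow> 'b::chilbert_space) \<Rightarrow> bool" where
  "isometric_on M f \<longleftrightarrow> clinear_on M f \<and> (\<forall>x\<in>M. \<forall>y\<in>M. cinner (f x) (f y) = cinner x y)"

definition orth_proj :: "'h::chilbert_space set \<Rightarrow> 'h \<Rightarrow> 'h" where
  "orth_proj M x = (THE y. y \<in> M \<and> (\<forall>z\<in>M. cinner z (x - y) = 0))"


section \<open>Self-dual cones\<close>

text \<open>
  All Hilbert spaces under consideration are closed subspaces of one ambient Hilbert space, given
  by a type of class \<^class>\<open>chilbert_space\<close>; \<open>\<HH>\<close> denotes such a subspace.
\<close>

definition hilbert_cone :: "'h::chilbert_space set \<Rightarrow> 'h set \<Rightarrow> bool" where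
  "hilbert_cone \<HH> P \<longleftrightarrow> P \<subseteq> \<HH> \<and> closed P \<and> convex_cone P \<and> P \<inter> uminus ` P = {0}"

definition self_dual_cone :: "'h::chilbert_space set \<Rightarrow> 'h set \<Rightarrow> bool" where
  "self_dual_cone \<HH> P \<longleftrightarrow> hilbert_cone \<HH> P \<and> P = {\<eta> \<in> \<HH>. \<forall>\<xi>\<in>P. 0 \<le> cinner \<eta> \<xi>}"

definition strictly_positive :: "'h::chilbert_space set \<Rightarrow> 'h \<Rightarrow> bool" where
  "strictly_positive P \<eta> \<longleftrightarrow> \<eta> \<in> P \<and> (\<forall>\<xi>\<in>P - {0}. 0 < cinner \<xi> \<eta>)"

definition positivity_preserving :: "'h::chilbert_space set \<Rightarrow> ('h \<Rightarrow> 'h) \<Rightarrow> bool" where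
  "positivity_preserving P T \<longleftrightarrow> T ` P \<subseteq> P"

definition positivity_improving :: "'h::chilbert_space set \<Rightarrow> ('h \<Rightarrow> 'h) \<Rightarrow> bool" where
  "positivity_improving P T \<longleftrightarrow> (\<forall>\<xi>\<in>P - {0}. strictly_positive P (T \<xi>))"


section \<open>Self-adjoint operators\<close>

text \<open>
  A possibly unbounded operator: the Hilbert space it acts in, its domain, and its action, which
  is meaningful on the domain only.
\<close>

record 'h hop =
  op_space :: "'h set"
  op_dom :: "'h set"
  op_app :: "'h \<Rightarrow> 'h"

definition linear_operator :: "'h::chilbert_space hop \<Rightarrow> bool" where
  "linear_operator T \<longleftrightarrow>
     closed_csubspace (op_space T) \<and> csubspace (op_dom T) \<and> op_dom T \<subseteq> op_space T \<and>
     op_app T ` op_dom T \<subseteq> op_space T \<and> clinear_on (op_dom T) (op_app T)"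

definition densely_defined :: "'h::chilbert_space hop \<Rightarrow> bool" where
  "densely_defined T \<longleftrightarrow> op_space T \<subseteq> closure (op_dom T)"

definition adjoint_graph :: "'h::chilbert_space hop \<Rightarrow> ('h \<times> 'h) set" where
  "adjoint_graph T = {(y, z). y \<in> op_space T \<and> z \<in> op_space T \<and>
     (\<forall>x\<in>op_dom T. cinner y (op_app T x) = cinner z x)}"

definition self_adjoint :: "'h::chilbert_space hop \<Rightarrow> bool" where
  "self_adjoint T \<longleftrightarrow> linear_operator T \<and> densely_defined T \<and>
     adjoint_graph T = {(x, op_app T x) |x. x \<in> op_dom T}"

definition bounded_from_below :: "'h::chilbert_space hop \<Rightarrow> bool" where
  "bounded_from_below T \<longleftrightarrow>
     (\<exists>c::real. \<forall>x\<in>op_dom T. complex_of_real (c * (norm x)\<^sup>2) \<le> cinner x (op_app T x))"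

definition resolvent_set :: "'h::chilbert_space hop \<Rightarrow> complex set" where
  "resolvent_set T = {z. bij_betw (\<lambda>x. op_app T x - z *\<^sub>C x) (op_dom T) (op_space T) \<and>
     (\<exists>C. \<forall>x\<in>op_dom T. norm x \<le> C * norm (op_app T x - z *\<^sub>C x))}"

definition spectrum :: "'h::chilbert_space hop \<Rightarrow> complex set" where
  "spectrum T = - resolvent_set T"

definition eigenspace :: "'h::chilbert_space hop \<Rightarrow> complex \<Rightarrow> 'h set" where
  "eigenspace T z = {x \<in> op_dom T. op_app T x = z *\<^sub>C x}"

text \<open>
  The discrete spectrum consists of the isolated points of the spectrum that are eigenvalues of
  finite multiplicity.  Here \<^term>\<open>span\<close> is the real linear span; for complex subspaces finite
  real and finite complex dimension are the same thing.
\<close>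

definition discrete_spectrum :: "'h::chilbert_space hop \<Rightarrow> complex set" where
  "discrete_spectrum T = {z. z isolated_in spectrum T \<and> eigenspace T z \<noteq> {0} \<and>
     (\<exists>B. finite B \<and> eigenspace T z \<subseteq> span B)}"

definition essential_spectrum :: "'h::chilbert_space hop \<Rightarrow> complex set" where
  "essential_spectrum T = spectrum T - discrete_spectrum T"

definition ground_energy :: "'h::chilbert_space hop \<Rightarrow> real" where
  "ground_energy T = Inf {r. complex_of_real r \<in> spectrum T}"

definition shifted_inverse :: "'h::chilbert_space hop \<Rightarrow> real \<Rightarrow> 'h \<Rightarrow> 'h" where
  "shifted_inverse T s = inv_into (op_dom T) (\<lambda>x. op_app T x + s *\<^sub>R x)"

text \<open>
  \<open>unitary_group T U\<close> says that \<open>U t = exp (i t T)\<close> for all real \<open>t\<close>, i.e. that \<open>U\<close> is the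
  strongly continuous one-parameter unitary group on \<^term>\<open>op_space T\<close> with generator \<open>i T\<close>.
  By Stone's theorem it exists and is unique for self-adjoint \<open>T\<close>.
\<close>

definition unitary_on :: "'h::chilbert_space set \<Rightarrow> ('h \<Rightarrow> 'h) \<Rightarrow> bool" where
  "unitary_on \<HH> V \<longleftrightarrow> isometric_on \<HH> V \<and> V ` \<HH> = \<HH>"

definition unitary_group :: "'h::chilbert_space hop \<Rightarrow> (real \<Rightarrow> 'h \<Rightarrow> 'h) \<Rightarrow> bool" where
  "unitary_group T U \<longleftrightarrow>
     (\<forall>t. unitary_on (op_space T) (U t)) \<and>
     (\<forall>x\<in>op_space T. U 0 x = x) \<and>
     (\<forall>s t. \<forall>x\<in>op_space T. U (s + t) x = U s (U t x)) \<and>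
     (\<forall>x\<in>op_space T. continuous_on UNIV (\<lambda>t. U t x)) \<and>
     (\<forall>x\<in>op_space T. \<forall>y. ((\<lambda>t. U t x) has_vector_derivative y) (at 0) \<longleftrightarrow>
        x \<in> op_dom T \<and> y = \<i> *\<^sub>C op_app T x)"

definition strongly_commute :: "'h::chilbert_space hop \<Rightarrow> 'h hop \<Rightarrow> bool" where
  "strongly_commute S T \<longleftrightarrow> op_space S = op_space T \<and>
     (\<exists>U V. unitary_group S U \<and> unitary_group T V \<and>
        (\<forall>s t. \<forall>x\<in>op_space T. U s (V t x) = V t (U s x)))"


section \<open>Inheritance of cones\<close>

definition A_plus :: "'h::chilbert_space set \<Rightarrow> 'h set \<Rightarrow> 'h hop set" where
  "A_plus \<HH> P = {H. op_space H = \<HH> \<and> self_adjoint H \<and> bounded_from_below H \<and>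
     essential_spectrum H = {} \<and>
     (\<forall>s > - ground_energy H. positivity_improving P (shifted_inverse H s))}"

definition cone_inherits ::
    "'h::chilbert_space set \<Rightarrow> 'h set \<Rightarrow> 'h set \<Rightarrow> 'h set \<Rightarrow> bool" where
  "cone_inherits \<HH>1 P1 \<HH>2 P2 \<longleftrightarrow>
     closed_csubspace \<HH>1 \<and> closed_csubspace \<HH>2 \<and> \<HH>1 \<subseteq> \<HH>2 \<and>
     self_dual_cone \<HH>1 P1 \<and> self_dual_cone \<HH>2 P2 \<and>
     P1 = orth_proj \<HH>1 ` P2 \<and> positivity_preserving P2 (orth_proj \<HH>1)"

definition inherits :: "'h::chilbert_space hop \<Rightarrow> 'h set \<Rightarrow> 'h hop \<Rightarrow> 'h set \<Rightarrow> bool" where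
  "inherits H1 P1 H2 P2 \<longleftrightarrow>
     H1 \<in> A_plus (op_space H1) P1 \<and> H2 \<in> A_plus (op_space H2) P2 \<and>
     cone_inherits (op_space H1) P1 (op_space H2) P2"


section \<open>The class of Hamiltonians, its preorder and the stability classes\<close>

text \<open>
  The reference space is \<^term>\<open>op_space Q\<close>, where \<open>Q\<close> is the bounded self-adjoint operator that
  gives rise to the good quantum number.  It is extended by zero to larger spaces \<open>\<HH>\<close>.
  Operators that differ only outside their common domain fall into the same class of the quotient.
\<close>

definition extend_by_zero :: "'h::chilbert_space hop \<Rightarrow> 'h set \<Rightarrow> 'h hop" where
  "extend_by_zero Q \<HH> = \<lparr>op_space = \<HH>, op_dom = \<HH>,
     op_app = (\<lambda>x. op_app Q (orth_proj (op_space Q) x))\<rparr>"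

definition hamiltonians0 :: "'h::chilbert_space set \<Rightarrow> 'h hop set" where
  "hamiltonians0 \<HH>s =
     (\<Union>\<HH>\<in>{\<HH>. closed_csubspace \<HH> \<and> closed_csubspace \<HH>s \<and> \<HH>s \<subseteq> \<HH>}.
        \<Union>P\<in>{P. self_dual_cone \<HH> P}. A_plus \<HH> P)"

definition hamiltonians :: "'h::chilbert_space hop \<Rightarrow> 'h hop set" where
  "hamiltonians Q =
     {H \<in> hamiltonians0 (op_space Q). strongly_commute (extend_by_zero Q (op_space H)) H}"

definition ham_arrow :: "'h::chilbert_space hop \<Rightarrow> 'h hop \<Rightarrow> 'h hop \<Rightarrow> bool" where
  "ham_arrow Q H K \<longleftrightarrow>
     (\<exists>N::nat. \<exists>(Hs::nat \<Rightarrow> 'h hop) (P::nat \<Rightarrow> 'h set) (P'::nat \<Rightarrow> 'h set).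
        2 \<le> N \<and> Hs 1 = H \<and> Hs N = K \<and>
        (\<forall>j\<in>{1..N}. Hs j \<in> hamiltonians Q) \<and>
        (\<forall>j\<in>{1..<N}. self_dual_cone (op_space (Hs j)) (P j)) \<and>
        (\<forall>j\<in>{2..N}. self_dual_cone (op_space (Hs j)) (P' j)) \<and>
        (\<forall>j\<in>{1..<N}. op_space (Hs j) \<subseteq> op_space (Hs (j + 1)) \<and>
           inherits (Hs j) (P j) (Hs (j + 1)) (P' (j + 1))))"

definition ham_equiv :: "'h::chilbert_space hop \<Rightarrow> ('h hop \<times> 'h hop) set" where
  "ham_equiv Q = {(H, K). H \<in> hamiltonians Q \<and> K \<in> hamiltonians Q \<and>
     ham_arrow Q H K \<and> ham_arrow Q K H}"

definition ham_classes :: "'h::chilbert_space hop \<Rightarrow> 'h hop set set" where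
  "ham_classes Q = hamiltonians Q // ham_equiv Q"

definition class_arrow :: "'h::chilbert_space hop \<Rightarrow> 'h hop set \<Rightarrow> 'h hop set \<Rightarrow> bool" where
  "class_arrow Q \<C> \<D> \<longleftrightarrow> (\<exists>H\<in>\<C>. \<exists>K\<in>\<D>. ham_arrow Q H K)"

definition stability_class :: "'h::chilbert_space hop \<Rightarrow> 'h hop \<Rightarrow> 'h hop set set" where
  "stability_class Q H = {\<C> \<in> ham_classes Q. class_arrow Q (ham_equiv Q `` {H}) \<C>}"

definition ground_vector :: "'h::chilbert_space hop \<Rightarrow> 'h" where
  "ground_vector H = (SOME \<psi>. \<psi> \<in> eigenspace H (complex_of_real (ground_energy H)) \<and> \<psi> \<noteq> 0 \<and>
     (\<exists>P. self_dual_cone (op_space H) P \<and> H \<in> A_plus (op_space H) P \<and> strictly_positive P \<psi>))"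

definition good_quantum_number :: "'h::chilbert_space hop \<Rightarrow> 'h hop \<Rightarrow> real" where
  "good_quantum_number Q H =
     (THE m. op_app (extend_by_zero Q (op_space H)) (ground_vector H) = m *\<^sub>R ground_vector H)"


section \<open>Spins\<close>

text \<open>
  The lattice is the finite type \<^typ>\<open>'x\<close>.  The tensor product of one copy of \<open>\<complex>\<^sup>2\<close> per site is
  realised in its product basis, which is indexed by the spin configurations
  \<open>\<sigma> :: 'x \<Rightarrow> 2\<close> (index \<open>1\<close> is spin up, index \<open>2\<close> spin down); \<open>spin x j\<close> is one half of
  the \<open>j\<close>-th Pauli matrix acting on the tensor factor at \<open>x\<close>.
\<close>

type_synonym 'x spin_space = "complex ^ ('x \<Rightarrow> 2)"

definition pauli :: "complex ^ 2 ^ 2 ^ 3" where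
  "pauli = vector [vector [vector [0, 1], vector [1, 0]],
                   vector [vector [0, - \<i>], vector [\<i>, 0]],
                   vector [vector [1, 0], vector [0, - 1]]]"

definition spin :: "'x::finite \<Rightarrow> 3 \<Rightarrow> 'x spin_space \<Rightarrow> 'x spin_space" where
  "spin x j v = (\<chi> \<sigma>. \<Sum>\<tau>\<in>UNIV. 1 / 2 * pauli $ j $ \<sigma> x $ \<tau> * v $ (\<sigma>(x := \<tau>)))"

definition spin_sum :: "'x::finite set \<Rightarrow> 3 \<Rightarrow> 'x spin_space \<Rightarrow> 'x spin_space" where
  "spin_sum X j v = (\<Sum>x\<in>X. spin x j v)"

definition spin_dot :: "'x::finite set \<Rightarrow> 'x set \<Rightarrow> 'x spin_space \<Rightarrow> 'x spin_space" where
  "spin_dot X Y v = (\<Sum>j\<in>UNIV. spin_sum X j (spin_sum Y j v))"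

definition total_spin_squared :: "'x::finite spin_space \<Rightarrow> 'x spin_space" where
  "total_spin_squared = spin_dot UNIV UNIV"

definition zero_magnetization :: "'x::finite spin_space set" where
  "zero_magnetization = {v. spin_sum UNIV 3 v = 0}"

lemma spin_commutator:
  "spin x 1 (spin y 2 v) - spin y 2 (spin x 1 v) = (if x = y then \<i> *\<^sub>C spin x 3 v else 0)"
  "spin x 2 (spin y 3 v) - spin y 3 (spin x 2 v) = (if x = y then \<i> *\<^sub>C spin x 1 v else 0)"
  "spin x 3 (spin y 1 v) - spin y 1 (spin x 3 v) = (if x = y then \<i> *\<^sub>C spin x 2 v else 0)"
  "spin x j (spin y j v) - spin y j (spin x j v) = 0"
proof -
  have ne: "spin x k (spin y l v) = spin y l (spin x k v)" if "x \<noteq> y" for k l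
    using that by (auto simp: spin_def vec_eq_iff sum_2 fun_upd_twist[of x y] algebra_simps)
  have two: "\<sigma> x = 1 \<or> \<sigma> x = 2" for \<sigma> :: "'a \<Rightarrow> 2"
    using exhaust_2 by blast
  note defs = spin_def pauli_def scaleC_vec_def scaleC_complex_def vec_eq_iff sum_2 algebra_simps
  have eq: "spin x 1 (spin x 2 v) - spin x 2 (spin x 1 v) = \<i> *\<^sub>C spin x 3 v"
    "spin x 2 (spin x 3 v) - spin x 3 (spin x 2 v) = \<i> *\<^sub>C spin x 1 v"
    "spin x 3 (spin x 1 v) - spin x 1 (spin x 3 v) = \<i> *\<^sub>C spin x 2 v"
    unfolding vec_eq_iff
    subgoal apply (rule allI) subgoal for \<sigma> using two[of \<sigma>] by (auto simp: defs) done
    subgoal apply (rule allI) subgoal for \<sigma> using two[of \<sigma>] by (auto simp: defs) done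
    subgoal apply (rule allI) subgoal for \<sigma> using two[of \<sigma>] by (auto simp: defs) done
    done
  show "spin x 1 (spin y 2 v) - spin y 2 (spin x 1 v) = (if x = y then \<i> *\<^sub>C spin x 3 v else 0)"
    "spin x 2 (spin y 3 v) - spin y 3 (spin x 2 v) = (if x = y then \<i> *\<^sub>C spin x 1 v else 0)"
    "spin x 3 (spin y 1 v) - spin y 1 (spin x 3 v) = (if x = y then \<i> *\<^sub>C spin x 2 v else 0)"
    "spin x j (spin y j v) - spin y j (spin x j v) = 0"
    using ne eq by (cases "x = y"; simp)+
qed

text \<open>
  The Hilbert spaces containing a given space \<open>M\<close> are handled through isometric embeddings
  \<open>\<iota>\<close> of \<open>M\<close>; \<open>embed_operator \<iota> M T\<close> is the restriction of \<open>T\<close> to \<open>M\<close>, transported to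
  the image of \<open>M\<close>.
\<close>

definition embed_operator ::
    "('a::chilbert_space \<Rightarrow> 'h::chilbert_space) \<Rightarrow> 'a set \<Rightarrow> ('a \<Rightarrow> 'a) \<Rightarrow> 'h hop" where
  "embed_operator \<iota> M T =
     \<lparr>op_space = \<iota> ` M, op_dom = \<iota> ` M, op_app = (\<lambda>y. \<iota> (T (inv_into M \<iota> y)))\<rparr>"

end

theory Submission
  imports Defs
begin

text \<open>
  The good quantum number is constant along the preorder, so it suffices to compute it for the
  Marshall-Lieb-Mattis Hamiltonian itself.

  It is constant for the following reason.  By the Perron-Frobenius theorem for self-dual cones
  (\<open>ground_state\<close>), the ground eigenspace of an operator in \<open>A_plus \<HH> P\<close> is a complex line spanned by
  a vector that is strictly positive with respect to \<open>P\<close>.  A strongly commuting operator leaves this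
  line invariant, so the good quantum number is the eigenvalue of the extended operator \<open>Q\<close> on the
  whole line, whichever cone is used (\<open>good_quantum_number_eigenvalue\<close>).  If \<open>H1\<close> with cone \<open>P1\<close> is
  inherited by \<open>H2\<close> with cone \<open>P2\<close>, then \<open>P1 = \<pi> P2 \<subseteq> P2\<close>, where \<open>\<pi>\<close> is the projection; hence the
  positive ground vector of \<open>H1\<close> is a nonzero element of \<open>P2\<close> and has a strictly positive inner product
  with the positive ground vector of \<open>H2\<close>.  Eigenvectors of one symmetric operator that are not
  orthogonal belong to the same eigenvalue (\<open>good_quantum_number_inherits\<close>).

  The operators may be unbounded.  That a ground vector exists at all comes from two facts: the
  infimum of the numerical range of a self-adjoint operator bounded from below is the least real
  point of its spectrum, and with empty essential spectrum this point is an eigenvalue.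
  Perron-Frobenius is then applied to the resolvent.

  For the Marshall-Lieb-Mattis Hamiltonian let \<open>|B| \<le> |A|\<close>.  Since \<open>S\<^sub>x \<cdot> S\<^sub>y\<close> is half the exchange of the
  spins at \<open>x\<close> and \<open>y\<close> minus a quarter, everything reduces to counting.  If \<open>n\<close> is the number of up
  spins in \<open>A\<close>, the vector with amplitudes \<open>(-1)\<^sup>n n! (|A| - n)!\<close> on the configurations of zero
  magnetization satisfies the single identity \<open>mlm_weight_sum_across\<close>, which makes it an eigenvector
  both of \<open>S\<^sub>A \<cdot> S\<^sub>B\<close> and of the squared total spin.  These amplitudes never vanish and change sign under
  every nontrivial exchange between the sublattices, so the arithmetic-geometric mean inequality shows
  that it minimises the energy (\<open>mlm_energy_lower_bound\<close>).  Its total spin \<open>S\<close> is \<open>(|A| - |B|) / 2\<close>.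
\<close>


section \<open>Complex inner products\<close>

lemma scaleC_one [simp]: "1 *\<^sub>C x = (x::'h::chilbert_space)"
  using scaleC_of_real[of 1 x] by simp

lemma scaleC_zero_left [simp]: "0 *\<^sub>C x = (0::'h::chilbert_space)"
  using scaleC_of_real[of 0 x] by simp

lemma scaleC_zero_right [simp]: "c *\<^sub>C (0::'h::chilbert_space) = 0"
  using scaleC_scaleC[of c 0 "0::'h"] by simp

lemma scaleC_minus_one: "(-1) *\<^sub>C x = - (x::'h::chilbert_space)"
  using scaleC_of_real[of "-1" x] by simp

lemma scaleC_minus_left: "(- c) *\<^sub>C x = - (c *\<^sub>C (x::'h::chilbert_space))"
  by (metis mult_minus1 scaleC_scaleC scaleC_minus_one)

lemma scaleC_minus_right: "c *\<^sub>C (- x) = - (c *\<^sub>C (x::'h::chilbert_space))"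
  by (metis add.right_inverse add_eq_0_iff scaleC_add_right scaleC_zero_right)

lemma scaleC_diff_right: "c *\<^sub>C (x - y) = c *\<^sub>C x - c *\<^sub>C (y::'h::chilbert_space)"
  by (metis diff_conv_add_uminus scaleC_add_right scaleC_minus_right)

lemma scaleC_scaleR_right: "c *\<^sub>C (r *\<^sub>R x) = r *\<^sub>R (c *\<^sub>C (x::'h::chilbert_space))"
  by (metis mult.commute scaleC_of_real scaleC_scaleC)

lemma scaleC_cancel: "c \<noteq> 0 \<Longrightarrow> inverse c *\<^sub>C c *\<^sub>C x = (x::'h::chilbert_space)"
  by (simp add: scaleC_scaleC)

lemma cinner_add_left: "cinner (x + y) z = cinner x z + cinner (y::'h::chilbert_space) z"
  by (metis cinner_add_right cinner_commute complex_cnj_add)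

lemma cinner_scaleC_left: "cinner (c *\<^sub>C x) z = cnj c * cinner (x::'h::chilbert_space) z"
  by (metis cinner_commute cinner_scaleC_right complex_cnj_mult)

lemma cinner_scaleR_right: "cinner x (r *\<^sub>R y) = of_real r * cinner x (y::'h::chilbert_space)"
  by (metis cinner_scaleC_right scaleC_of_real)

lemma cinner_scaleR_left: "cinner (r *\<^sub>R x) y = of_real r * cinner x (y::'h::chilbert_space)"
  by (metis cinner_scaleC_left complex_cnj_complex_of_real scaleC_of_real)

lemma cinner_zero_right [simp]: "cinner x (0::'h::chilbert_space) = 0"
  using cinner_scaleR_right[of x 0 0] by simp

lemma cinner_zero_left [simp]: "cinner (0::'h::chilbert_space) x = 0"
  using cinner_scaleR_left[of 0 0 x] by simp

lemma cinner_minus_right: "cinner x (- y) = - cinner x (y::'h::chilbert_space)"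
  using cinner_scaleR_right[of x "-1" y] by simp

lemma cinner_minus_left: "cinner (- x) y = - cinner x (y::'h::chilbert_space)"
  using cinner_scaleR_left[of "-1" x y] by simp

lemma cinner_diff_right: "cinner x (y - z) = cinner x y - cinner x (z::'h::chilbert_space)"
  by (metis cinner_add_right cinner_minus_right diff_conv_add_uminus)

lemma cinner_diff_left: "cinner (x - y) z = cinner x z - cinner y (z::'h::chilbert_space)"
  by (metis cinner_add_left cinner_minus_left diff_conv_add_uminus)

lemmas cinner_simps = cinner_add_left cinner_add_right cinner_scaleC_left cinner_scaleC_right
  cinner_scaleR_left cinner_scaleR_right cinner_minus_left cinner_minus_right
  cinner_diff_left cinner_diff_right

text \<open>
  Expressing the complex inner product through the real one transfers the continuity of the latter.
\<close>

lemma cinner_eq_inner: "cinner x y = Complex (inner x y) (inner (\<i> *\<^sub>C x) (y::'h::chilbert_space))"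
  by (simp add: complex_eq_iff inner_eq_Re_cinner cinner_simps)

lemma cinner_same: "cinner x x = of_real ((norm (x::'h::chilbert_space))\<^sup>2)"
proof -
  have "Im (cinner x x) = 0"
    using cinner_commute[of x x] by (metis Im_complex_of_real Reals_cnj_iff Reals_cases)
  then show ?thesis
    by (simp add: complex_eq_iff power2_norm_eq_inner inner_eq_Re_cinner)
qed

lemma cinner_same_eq_0 [simp]: "cinner x x = 0 \<longleftrightarrow> (x::'h::chilbert_space) = 0"
  by (simp add: cinner_same)

lemma norm_scaleC: "norm (c *\<^sub>C x) = cmod c * norm (x::'h::chilbert_space)"
proof -
  have "complex_of_real ((norm (c *\<^sub>C x))\<^sup>2) = cinner (c *\<^sub>C x) (c *\<^sub>C x)"
    by (simp only: cinner_same)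
  also have "\<dots> = (cnj c * c) * cinner x x"
    by (simp add: cinner_simps)
  also have "\<dots> = of_real ((cmod c * norm x)\<^sup>2)"
    unfolding cinner_same by (metis complex_norm_square mult.commute of_real_mult power_mult_distrib)
  finally have "(norm (c *\<^sub>C x))\<^sup>2 = (cmod c * norm x)\<^sup>2"
    by (simp only: of_real_eq_iff)
  then show ?thesis by simp
qed

lemma tendsto_scaleC:
  fixes f :: "_ \<Rightarrow> 'h::chilbert_space"
  assumes "(f \<longlongrightarrow> l) F"
  shows "((\<lambda>n. c *\<^sub>C f n) \<longlongrightarrow> c *\<^sub>C l) F"
proof -
  have "bounded_linear (\<lambda>x::'h. c *\<^sub>C x)"
    by (rule bounded_linear_intro[where K = "cmod c"])
      (auto simp: scaleC_add_right scaleC_scaleR_right norm_scaleC mult.commute)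
  then show ?thesis using assms by (rule bounded_linear.tendsto)
qed

lemma tendsto_cinner:
  fixes f g :: "_ \<Rightarrow> 'h::chilbert_space"
  assumes "(f \<longlongrightarrow> l) F" and "(g \<longlongrightarrow> m) F"
  shows "((\<lambda>n. cinner (f n) (g n)) \<longlongrightarrow> cinner l m) F"
  unfolding cinner_eq_inner
  by (intro tendsto_intros tendsto_scaleC assms)

lemma csubspace_add: "csubspace M \<Longrightarrow> x \<in> M \<Longrightarrow> y \<in> M \<Longrightarrow> x + y \<in> M"
  and csubspace_scaleC: "csubspace M \<Longrightarrow> x \<in> M \<Longrightarrow> c *\<^sub>C x \<in> M"
  and csubspace_0: "csubspace M \<Longrightarrow> 0 \<in> M"
  by (auto simp: csubspace_def)

lemma csubspace_scaleR: "csubspace M \<Longrightarrow> x \<in> M \<Longrightarrow> r *\<^sub>R x \<in> M"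
  by (metis csubspace_scaleC scaleC_of_real)

lemma csubspace_minus: "csubspace M \<Longrightarrow> x \<in> M \<Longrightarrow> - x \<in> M"
  by (metis csubspace_scaleC scaleC_minus_one)

lemma csubspace_diff: "csubspace M \<Longrightarrow> x \<in> M \<Longrightarrow> y \<in> M \<Longrightarrow> x - y \<in> M"
  by (metis csubspace_add csubspace_minus diff_conv_add_uminus)

lemma csubspace_imp_subspace: "csubspace M \<Longrightarrow> subspace M"
  by (simp add: subspace_def csubspace_0 csubspace_add csubspace_scaleR)

lemma clinear_on_add: "clinear_on M f \<Longrightarrow> x \<in> M \<Longrightarrow> y \<in> M \<Longrightarrow> f (x + y) = f x + f y"
  and clinear_on_scaleC: "clinear_on M f \<Longrightarrow> x \<in> M \<Longrightarrow> f (c *\<^sub>C x) = c *\<^sub>C f x"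
  by (auto simp: clinear_on_def)

lemma clinear_on_scaleR: "clinear_on M f \<Longrightarrow> x \<in> M \<Longrightarrow> f (r *\<^sub>R x) = r *\<^sub>R f x"
  by (metis clinear_on_scaleC scaleC_of_real)

lemma clinear_on_diff:
  assumes "clinear_on M f" "csubspace M" "x \<in> M" "y \<in> M"
  shows "f (x - y) = f x - f y"
  using clinear_on_add[OF assms(1) csubspace_diff[OF assms(2-4)] assms(4)] by simp

lemma isometric_on_norm:
  assumes "isometric_on M f" "x \<in> M"
  shows "norm (f x) = norm x"
proof -
  have "cinner (f x) (f x) = cinner x x"
    using assms by (simp add: isometric_on_def)
  then have "(norm (f x))\<^sup>2 = (norm x)\<^sup>2"
    unfolding cinner_same by (simp only: of_real_eq_iff)
  then show ?thesis by simp
qed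

section \<open>Projections onto closed convex sets and subspaces\<close>

text \<open>
  The points of the set that are almost nearest form a decreasing sequence of closed sets, whose
  diameters tend to \<open>0\<close> by the parallelogram law.  Completeness then gives a common point.
\<close>

lemma closed_convex_nearest_point:
  fixes S :: "'a::{real_inner, complete_space} set"
  assumes "closed S" "convex S" "S \<noteq> {}"
  obtains a where "a \<in> S" "\<And>z. z \<in> S \<Longrightarrow> dist x a \<le> dist x z"
proof -
  define d where "d = infdist x S"
  have d: "d \<le> dist x z" if "z \<in> S" for z
    using that by (simp add: d_def infdist_le)
  have d0: "0 \<le> d" by (simp add: d_def infdist_nonneg)
  define D where "D n = {z \<in> S. (dist x z)\<^sup>2 \<le> d\<^sup>2 + 1 / real (Suc n)}" for n
  obtain a where a: "\<And>n. a \<in> D n"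
  proof (rule decreasing_closed_nest[of D])
    show "closed (D n)" for n
    proof -
      have "closed {z. (dist x z)\<^sup>2 \<le> d\<^sup>2 + 1 / real (Suc n)}"
        by (intro closed_Collect_le continuous_intros)
      moreover have "D n = S \<inter> {z. (dist x z)\<^sup>2 \<le> d\<^sup>2 + 1 / real (Suc n)}"
        by (auto simp: D_def)
      ultimately show ?thesis using assms(1) by auto
    qed
    show "D n \<noteq> {}" for n
    proof -
      have "d < sqrt (d\<^sup>2 + 1 / real (Suc n))"
        by (rule real_less_rsqrt) simp
      then obtain z where "z \<in> S" "dist x z < sqrt (d\<^sup>2 + 1 / real (Suc n))"
        unfolding d_def infdist_notempty[OF assms(3)]
        using cINF_less_iff[OF assms(3)] by (metis bdd_below_image_dist)
      then have "(dist x z)\<^sup>2 \<le> d\<^sup>2 + 1 / real (Suc n)"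
        by (metis less_imp_le real_sqrt_le_iff real_sqrt_unique zero_le_dist)
      then show ?thesis using \<open>z \<in> S\<close> by (auto simp: D_def)
    qed
    show "D n \<subseteq> D m" if "m \<le> n" for m n
    proof -
      have "1 / real (Suc n) \<le> 1 / real (Suc m)"
        using that by (simp add: frac_le)
      then show ?thesis by (auto simp: D_def)
    qed
    show "\<exists>n. \<forall>y\<in>D n. \<forall>z\<in>D n. dist y z < e" if "e > 0" for e
    proof -
      obtain n where n: "1 / real (Suc n) < e\<^sup>2 / 4"
        using reals_Archimedean[of "e\<^sup>2 / 4"] \<open>e > 0\<close> by (force simp: inverse_eq_divide)
      have "dist y z < e" if y: "y \<in> D n" and z: "z \<in> D n" for y z
      proof -
        \<comment> \<open>The midpoint lies in the set, hence it is not closer to \<open>x\<close> than \<open>d\<close>.\<close>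
        define w where "w = (1/2) *\<^sub>R y + (1/2) *\<^sub>R z"
        have "w \<in> S"
          unfolding w_def using y z assms(2) by (auto simp: D_def convex_def)
        then have "d\<^sup>2 \<le> (dist x w)\<^sup>2"
          using d d0 by (simp add: power_mono)
        moreover have "(dist y z)\<^sup>2 = 2 * (dist x y)\<^sup>2 + 2 * (dist x z)\<^sup>2 - 4 * (dist x w)\<^sup>2"
          by (simp add: w_def dist_norm power2_norm_eq_inner inner_simps inner_commute algebra_simps)
        ultimately have "(dist y z)\<^sup>2 \<le> 4 / real (Suc n)"
          using y z by (auto simp: D_def)
        then have "(dist y z)\<^sup>2 < e\<^sup>2" using n by linarith
        then show ?thesis using \<open>e > 0\<close> by (simp add: power_less_imp_less_base)
      qed
      then show ?thesis by blast
    qed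
  qed blast
  have "(dist x a)\<^sup>2 \<le> d\<^sup>2"
  proof (rule field_le_epsilon)
    fix e :: real assume "e > 0"
    then obtain n where "1 / real (Suc n) < e" using nat_approx_posE by blast
    then show "(dist x a)\<^sup>2 \<le> d\<^sup>2 + e" using a[of n] by (auto simp: D_def)
  qed
  then have "dist x a \<le> d" using d0 by (rule power2_le_imp_le)
  moreover have "a \<in> S" using a[of 0] by (simp add: D_def)
  ultimately show ?thesis using that[of a] order_trans[OF _ d] by blast
qed

text \<open>
  Moreau's theorem: the residual \<open>x - a\<close> lies in the polar cone and is orthogonal to \<open>a\<close>.  The cone
  allows the nearest point \<open>a\<close> to be compared with its own multiples \<open>2 a\<close> and \<open>0\<close>, which gives the
  orthogonality.
\<close>

lemma closed_convex_cone_projection: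
  fixes P :: "'a::{real_inner, complete_space} set"
  assumes "closed P" "convex_cone P"
  obtains a where "a \<in> P" "inner (x - a) a = 0" "\<And>z. z \<in> P \<Longrightarrow> inner (x - a) z \<le> 0"
proof -
  have c: "convex P" and ne: "P \<noteq> {}" using assms(2) by (auto simp: convex_cone_def)
  obtain a where a: "a \<in> P" "\<And>z. z \<in> P \<Longrightarrow> dist x a \<le> dist x z"
    using closed_convex_nearest_point[OF assms(1) c ne] by metis
  have *: "inner (x - a) (z - a) \<le> 0" if "z \<in> P" for z
    by (rule any_closest_point_dot[OF c assms(1) a(1) that]) (use a in auto)
  have "inner (x - a) (2 *\<^sub>R a - a) \<le> 0" "inner (x - a) (0 *\<^sub>R a - a) \<le> 0"
    using *[OF convex_cone_scaleR[OF assms(2) _ a(1), of 2]]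
      *[OF convex_cone_scaleR[OF assms(2) _ a(1), of 0]] by simp_all
  then have 0: "inner (x - a) a = 0" by (simp add: inner_simps)
  then have "inner (x - a) z \<le> 0" if "z \<in> P" for z
    using *[OF that] by (simp add: inner_diff_right)
  then show ?thesis using that a(1) 0 by blast
qed

lemma closed_subspace_projection:
  fixes M :: "'a::{real_inner, complete_space} set"
  assumes "closed M" "subspace M"
  obtains a where "a \<in> M" "\<And>z. z \<in> M \<Longrightarrow> inner (x - a) z = 0"
proof -
  have "convex_cone M"
    using assms(2) subspace_0[OF assms(2)]
    by (auto simp: convex_cone_def subspace_imp_convex subspace_imp_conic)
  then obtain a where a: "a \<in> M" "\<And>z. z \<in> M \<Longrightarrow> inner (x - a) z \<le> 0"
    using closed_convex_cone_projection[OF assms(1)] by metis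
  have "inner (x - a) z = 0" if "z \<in> M" for z
    using a(2)[OF that] a(2)[of "- z"] that assms(2) by (simp add: subspace_neg)
  then show ?thesis using that a(1) by blast
qed

lemma cinner_eq_0_on_csubspaceI:
  assumes "csubspace M" "\<And>z. z \<in> M \<Longrightarrow> inner x z = 0" "z \<in> M"
  shows "cinner z x = 0"
proof -
  have "inner z x = 0" "inner (\<i> *\<^sub>C z) x = 0"
    using assms(2)[OF assms(3)] assms(2)[OF csubspace_scaleC[OF assms(1,3), of \<i>]]
    by (simp_all add: inner_commute)
  then show ?thesis by (simp add: cinner_eq_inner complex_eq_iff)
qed

lemma orth_proj_eqI:
  assumes "csubspace M" "y \<in> M" "\<And>z. z \<in> M \<Longrightarrow> cinner z (x - y) = 0"
  shows "orth_proj M x = y"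
  unfolding orth_proj_def
proof (rule the_equality)
  show "y \<in> M \<and> (\<forall>z\<in>M. cinner z (x - y) = 0)" using assms by blast
next
  fix w assume w: "w \<in> M \<and> (\<forall>z\<in>M. cinner z (x - w) = 0)"
  then have "w - y \<in> M" using assms csubspace_diff by blast
  then have "cinner (w - y) (x - y) = 0" "cinner (w - y) (x - w) = 0"
    using assms w by auto
  then have "cinner (w - y) (w - y) = 0" by (simp add: cinner_simps)
  then show "w = y" by simp
qed

lemma orth_proj:
  assumes "closed_csubspace M"
  shows orth_proj_in: "orth_proj M x \<in> M"
    and orth_proj_orth: "z \<in> M \<Longrightarrow> cinner z (x - orth_proj M x) = 0"
proof -
  have M: "csubspace M" "closed M" using assms by (auto simp: closed_csubspace_def)
  obtain a where a: "a \<in> M" "\<And>z. z \<in> M \<Longrightarrow> inner (x - a) z = 0"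
    using closed_subspace_projection[OF M(2) csubspace_imp_subspace[OF M(1)]] by metis
  have *: "cinner z (x - a) = 0" if "z \<in> M" for z
    using cinner_eq_0_on_csubspaceI[OF M(1)] a(2) that by blast
  have "orth_proj M x = a"
    using orth_proj_eqI[OF M(1) a(1) *] by blast
  then show "orth_proj M x \<in> M" "z \<in> M \<Longrightarrow> cinner z (x - orth_proj M x) = 0"
    using a * by auto
qed

lemma orth_proj_id: "csubspace M \<Longrightarrow> x \<in> M \<Longrightarrow> orth_proj M x = x"
  by (rule orth_proj_eqI) auto

lemma cinner_orth_proj_right:
  assumes "closed_csubspace M" "z \<in> M"
  shows "cinner z (orth_proj M x) = cinner z x"
  using orth_proj_orth[OF assms, of x] by (simp add: cinner_diff_right)

lemma cinner_orth_proj_left: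
  assumes "closed_csubspace M" "z \<in> M"
  shows "cinner (orth_proj M x) z = cinner x z"
  by (metis assms cinner_orth_proj_right cinner_commute)

text \<open>
  This is how ranges are shown to be everything: closedness of the range and triviality of its
  complement.
\<close>

lemma csubspace_eq_if_orth_trivial:
  assumes "closed_csubspace N" "csubspace M" "N \<subseteq> M"
    and "\<And>y. y \<in> M \<Longrightarrow> (\<And>z. z \<in> N \<Longrightarrow> cinner y z = 0) \<Longrightarrow> y = 0"
  shows "N = M"
proof
  show "M \<subseteq> N"
  proof
    fix x assume x: "x \<in> M"
    let ?y = "x - orth_proj N x"
    have "?y \<in> M" using x assms orth_proj_in csubspace_diff by blast
    moreover have "cinner ?y z = 0" if "z \<in> N" for z
      using orth_proj_orth[OF assms(1) that, of x] by (metis cinner_commute complex_cnj_zero)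
    ultimately have "?y = 0" using assms(4) by blast
    then show "x \<in> N" using orth_proj_in[OF assms(1), of x] by simp
  qed
qed fact


section \<open>Self-adjoint operators bounded from below\<close>

lemma self_adjoint_linear:
  assumes "self_adjoint T"
  shows self_adjoint_space: "csubspace (op_space T)" "closed (op_space T)"
    and self_adjoint_dom: "csubspace (op_dom T)" "x \<in> op_dom T \<Longrightarrow> x \<in> op_space T"
    and self_adjoint_clinear: "clinear_on (op_dom T) (op_app T)"
    and self_adjoint_app: "x \<in> op_dom T \<Longrightarrow> op_app T x \<in> op_space T"
  using assms by (auto simp: self_adjoint_def linear_operator_def closed_csubspace_def)

lemma self_adjoint_symmetric:
  assumes "self_adjoint T" "x \<in> op_dom T" "y \<in> op_dom T"
  shows "cinner x (op_app T y) = cinner (op_app T x) y"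
proof -
  have "(x, op_app T x) \<in> adjoint_graph T"
    using assms by (auto simp: self_adjoint_def)
  then show ?thesis using assms(3) by (auto simp: adjoint_graph_def)
qed

lemma self_adjoint_maximal:
  assumes "self_adjoint T" "y \<in> op_space T" "z \<in> op_space T"
    and "\<And>x. x \<in> op_dom T \<Longrightarrow> cinner y (op_app T x) = cinner z x"
  shows "y \<in> op_dom T" "op_app T y = z"
proof -
  have "(y, z) \<in> adjoint_graph T"
    using assms(2-4) by (auto simp: adjoint_graph_def)
  then show "y \<in> op_dom T" "op_app T y = z"
    using assms(1) by (auto simp: self_adjoint_def)
qed

text \<open>
  Adjoints are closed, and a self-adjoint operator is its own adjoint.
\<close>

lemma self_adjoint_closed_graph:
  assumes "self_adjoint T" "\<And>n::nat. x n \<in> op_dom T"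
    and "x \<longlonglongrightarrow> a" "(\<lambda>n. op_app T (x n)) \<longlonglongrightarrow> b"
  shows "a \<in> op_dom T" "op_app T a = b"
proof -
  have "closed (op_space T)" using assms(1) by (rule self_adjoint_space)
  then have ab: "a \<in> op_space T" "b \<in> op_space T"
    using assms by (meson closed_sequentially self_adjoint_dom(2) self_adjoint_app)+
  have "cinner a (op_app T u) = cinner b u" if u: "u \<in> op_dom T" for u
  proof (rule LIMSEQ_unique)
    show "(\<lambda>n. cinner (x n) (op_app T u)) \<longlonglongrightarrow> cinner a (op_app T u)"
      by (intro tendsto_cinner assms tendsto_const)
    have "(\<lambda>n. cinner (op_app T (x n)) u) \<longlonglongrightarrow> cinner b u"
      by (intro tendsto_cinner assms tendsto_const)
    then show "(\<lambda>n. cinner (x n) (op_app T u)) \<longlonglongrightarrow> cinner b u"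
      using self_adjoint_symmetric[OF assms(1) assms(2) u] by simp
  qed
  then show "a \<in> op_dom T" "op_app T a = b"
    using self_adjoint_maximal[OF assms(1) ab] by auto
qed

lemma norm_bound_below_numerical_range:
  assumes "x \<in> op_dom T" "m * (norm x)\<^sup>2 \<le> inner x (op_app T x)"
  shows "(m - z) * norm x \<le> norm (op_app T x - complex_of_real z *\<^sub>C x)"
proof (cases "x = 0")
  case False
  have "(m - z) * (norm x)\<^sup>2 \<le> inner x (op_app T x - complex_of_real z *\<^sub>C x)"
    using assms(2) by (simp add: scaleC_of_real inner_simps power2_norm_eq_inner algebra_simps)
  also have "\<dots> \<le> norm x * norm (op_app T x - complex_of_real z *\<^sub>C x)"
    by (rule norm_cauchy_schwarz)
  finally show ?thesis using False by (simp add: power2_eq_square)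
qed simp

text \<open>
  Below the numerical range \<open>T - z\<close> is bounded from below by \<open>m - z\<close>, so it is injective with closed
  range.  A vector orthogonal to the range is an eigenvector of the adjoint, that is of \<open>T\<close>, for the
  eigenvalue \<open>z\<close>, and is zero by the same bound.
\<close>

lemma resolvent_below_numerical_range:
  assumes sa: "self_adjoint T"
    and m: "\<And>x. x \<in> op_dom T \<Longrightarrow> m * (norm x)\<^sup>2 \<le> inner x (op_app T x)" and "z < m"
  shows "complex_of_real z \<in> resolvent_set T"
proof -
  define S where "S x = op_app T x - complex_of_real z *\<^sub>C x" for x
  note sub = self_adjoint_space(1)[OF sa] self_adjoint_dom(1)[OF sa]
  note T_add = clinear_on_add[OF self_adjoint_clinear[OF sa]]
  note T_scale = clinear_on_scaleC[OF self_adjoint_clinear[OF sa]]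
  note T_diff = clinear_on_diff[OF self_adjoint_clinear[OF sa] sub(2)]
  have bound: "norm x \<le> 1 / (m - z) * norm (S x)" if "x \<in> op_dom T" for x
    using norm_bound_below_numerical_range[OF that m[OF that], of z] \<open>z < m\<close>
    by (simp add: S_def field_simps)
  have S_diff: "S (x - y) = S x - S y" if "x \<in> op_dom T" "y \<in> op_dom T" for x y
    using that by (simp add: S_def T_diff scaleC_diff_right)
  have S_in: "S x \<in> op_space T" if "x \<in> op_dom T" for x
    unfolding S_def using that sa sub
    by (intro csubspace_diff csubspace_scaleC self_adjoint_app self_adjoint_dom(2))
  have "inj_on S (op_dom T)"
  proof (rule inj_onI)
    fix x y assume xy: "x \<in> op_dom T" "y \<in> op_dom T" "S x = S y"
    then show "x = y"
      using bound[of "x - y"] S_diff[of x y] sub by (simp add: csubspace_diff)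
  qed
  moreover have "S ` op_dom T = op_space T"
  proof (rule csubspace_eq_if_orth_trivial)
    show "closed_csubspace (S ` op_dom T)"
      unfolding closed_csubspace_def
    proof
      have "\<exists>w\<in>op_dom T. S x + S y = S w" if "x \<in> op_dom T" "y \<in> op_dom T" for x y
        using that sub by (intro bexI[of _ "x + y"])
          (auto simp: S_def T_add scaleC_add_right csubspace_add)
      moreover have "\<exists>w\<in>op_dom T. c *\<^sub>C S x = S w" if "x \<in> op_dom T" for x c
        using that sub by (intro bexI[of _ "c *\<^sub>C x"])
          (auto simp: S_def T_scale scaleC_diff_right scaleC_scaleC csubspace_scaleC mult.commute)
      moreover have "\<exists>w\<in>op_dom T. 0 = S w"
        using sub S_diff[of 0 0] by (intro bexI[of _ 0]) (auto simp: csubspace_0)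
      ultimately show "csubspace (S ` op_dom T)"
        unfolding csubspace_def by (auto simp: image_iff)
      show "closed (S ` op_dom T)"
        unfolding closed_sequential_limits
      proof (intro allI impI, elim conjE)
        fix y l assume y: "\<forall>n. y n \<in> S ` op_dom T" and l: "y \<longlonglongrightarrow> l"
        then have "\<forall>n. \<exists>x. x \<in> op_dom T \<and> y n = S x" by auto
        then obtain x where x: "\<And>n. x n \<in> op_dom T" "\<And>n. y n = S (x n)" by metis
        have "Cauchy x"
        proof (rule metric_CauchyI)
          fix e :: real assume "e > 0"
          then have "e * (m - z) > 0" using \<open>z < m\<close> by simp
          with LIMSEQ_imp_Cauchy[OF l] obtain N
            where N: "\<And>i j. i \<ge> N \<Longrightarrow> j \<ge> N \<Longrightarrow> dist (y i) (y j) < e * (m - z)"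
            unfolding Cauchy_def by metis
          have "dist (x i) (x j) < e" if "i \<ge> N" "j \<ge> N" for i j
          proof -
            have "dist (x i) (x j) \<le> 1 / (m - z) * dist (y i) (y j)"
              using bound[of "x i - x j"] x sub by (simp add: dist_norm S_diff csubspace_diff)
            also have "\<dots> < e"
              using N[OF that] \<open>z < m\<close> by (simp add: pos_divide_less_eq)
            finally show ?thesis .
          qed
          then show "\<exists>N. \<forall>i\<ge>N. \<forall>j\<ge>N. dist (x i) (x j) < e" by blast
        qed
        then obtain a where a: "x \<longlonglongrightarrow> a" using Cauchy_convergent_iff convergent_def by blast
        have "(\<lambda>n. y n + complex_of_real z *\<^sub>C x n) \<longlonglongrightarrow> l + complex_of_real z *\<^sub>C a"
          by (intro tendsto_add l tendsto_scaleC a)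
        then have "(\<lambda>n. op_app T (x n)) \<longlonglongrightarrow> l + complex_of_real z *\<^sub>C a"
          by (simp add: x S_def)
        from self_adjoint_closed_graph[OF sa x(1) a this]
        show "l \<in> S ` op_dom T" by (auto simp: image_iff S_def intro!: bexI[of _ a])
      qed
    qed
    show "S ` op_dom T \<subseteq> op_space T" using S_in by blast
    fix y assume y: "y \<in> op_space T" and orth: "\<And>w. w \<in> S ` op_dom T \<Longrightarrow> cinner y w = 0"
    have *: "cinner y (op_app T x) = cinner (complex_of_real z *\<^sub>C y) x" if "x \<in> op_dom T" for x
      using orth[of "S x"] that by (simp add: S_def cinner_simps)
    have "complex_of_real z *\<^sub>C y \<in> op_space T" using y sub by (simp add: csubspace_scaleC)
    from self_adjoint_maximal[OF sa y this *]
    have "y \<in> op_dom T" "S y = 0" by (auto simp: S_def)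
    then show "y = 0" using bound[of y] by simp
  qed (use sub in auto)
  ultimately have "bij_betw S (op_dom T) (op_space T)"
    by (simp add: bij_betw_def)
  moreover have "\<exists>C. \<forall>x\<in>op_dom T. norm x \<le> C * norm (S x)"
    using bound by (intro exI[of _ "1 / (m - z)"]) simp
  ultimately show ?thesis
    by (simp add: resolvent_set_def S_def[abs_def])
qed

text \<open>
  The form of \<open>T - m\<close> is nonnegative.  If \<open>T - m\<close> were boundedly invertible, a unit vector \<open>x\<close> on which
  the form is very small and its preimage \<open>y\<close> would violate the Cauchy-Schwarz inequality of this form,
  because the form pairs \<open>x\<close> with \<open>y\<close> to \<open>1\<close>.
\<close>

lemma numerical_range_infimum_in_spectrum:
  assumes sa: "self_adjoint T"
    and m: "\<And>x. x \<in> op_dom T \<Longrightarrow> m * (norm x)\<^sup>2 \<le> inner x (op_app T x)"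
    and approx: "\<And>e. e > 0 \<Longrightarrow> \<exists>x\<in>op_dom T. norm x = 1 \<and> inner x (op_app T x) < m + e"
  shows "complex_of_real m \<in> spectrum T"
proof (rule ccontr)
  define S where "S x = op_app T x - complex_of_real m *\<^sub>C x" for x
  note T_diff = clinear_on_diff[OF self_adjoint_clinear[OF sa] self_adjoint_dom(1)[OF sa]]
  assume "complex_of_real m \<notin> spectrum T"
  then have "bij_betw S (op_dom T) (op_space T)" and "\<exists>C. \<forall>x\<in>op_dom T. norm x \<le> C * norm (S x)"
    by (auto simp: spectrum_def resolvent_set_def S_def[abs_def])
  then obtain C0 where bij: "bij_betw S (op_dom T) (op_space T)"
    and C0: "\<And>x. x \<in> op_dom T \<Longrightarrow> norm x \<le> C0 * norm (S x)" by auto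
  define C where "C = \<bar>C0\<bar> + 1"
  have "C > 0" by (simp add: C_def)
  then obtain x where x: "x \<in> op_dom T" "norm x = 1" "inner x (op_app T x) < m + 1 / C"
    using approx[of "1 / C"] by auto
  have "x \<in> op_space T" using x sa self_adjoint_dom(2) by blast
  then have "x \<in> S ` op_dom T" using bij by (simp add: bij_betw_def)
  then obtain y where y: "y \<in> op_dom T" "S y = x" by blast
  have "norm y \<le> C" using C0[OF y(1)] y(2) x(2) by (simp add: C_def)
  then have "inner y (S y) \<le> C" using norm_cauchy_schwarz[of y x] x(2) y(2) by simp
  have "inner x (S x) < 1 / C"
    using x by (simp add: S_def inner_simps scaleC_of_real power2_norm_eq_inner[symmetric])
  have "inner y (op_app T x) = inner (op_app T y) x"
    using self_adjoint_symmetric[OF sa y(1) x(1)] by (simp add: inner_eq_Re_cinner)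
  then have sym: "inner y (S x) = inner (S y) x"
    by (simp add: S_def inner_simps scaleC_of_real)
  have "inner x (S y) = 1" using x y by (simp add: power2_norm_eq_inner[symmetric])
  \<comment> \<open>The combination of \<open>x\<close> and \<open>y\<close> that makes the quadratic form negative.\<close>
  define w where "w = x - (1 / C) *\<^sub>R y"
  have w: "w \<in> op_dom T"
    using x y sa by (simp add: w_def csubspace_diff csubspace_scaleR self_adjoint_dom(1))
  have "S w = S x - (1 / C) *\<^sub>R S y"
    using x y sa by (simp add: S_def w_def T_diff csubspace_scaleR self_adjoint_dom(1)
        clinear_on_scaleR[OF self_adjoint_clinear[OF sa]] scaleC_diff_right scaleC_scaleR_right algebra_simps)
  then have "inner w (S w) = inner w (S x - (1 / C) *\<^sub>R S y)" by simp
  also have "\<dots> = inner x (S x) - 2 / C * inner x (S y) + (1 / C)\<^sup>2 * inner y (S y)"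
    using sym by (simp add: w_def inner_simps inner_commute power2_eq_square algebra_simps)
  also have "\<dots> < 1 / C - 2 / C + (1 / C)\<^sup>2 * C"
    using \<open>inner x (S x) < 1 / C\<close> \<open>inner x (S y) = 1\<close> \<open>inner y (S y) \<le> C\<close>
    by (intro add_less_le_mono mult_left_mono) auto
  also have "\<dots> = 0" using \<open>C > 0\<close> by (simp add: power2_eq_square field_simps)
  finally have "inner w (S w) < 0" .
  moreover have "inner w (S w) \<ge> 0"
    using m[OF w] by (simp add: S_def inner_simps scaleC_of_real power2_norm_eq_inner)
  ultimately show False by simp
qed

text \<open>
  Ensures that the numerical range is nonempty.
\<close>

lemma densely_defined_nontrivial:
  assumes "densely_defined T" "op_space T \<noteq> {0}" "csubspace (op_space T)"
  obtains x where "x \<in> op_dom T" "x \<noteq> 0"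
proof (cases "op_dom T \<subseteq> {0}")
  case True
  then have "closure (op_dom T) \<subseteq> {0}" by (simp add: closure_minimal)
  then show ?thesis
    using assms csubspace_0[OF assms(3)] by (auto simp: densely_defined_def)
qed (use that in blast)

text \<open>
  The ground energy is defined through the spectrum.  Identifying it with the infimum of the numerical
  range makes it usable for variational estimates, and the absence of essential spectrum turns it into
  an eigenvalue.
\<close>

lemma ground_energy_properties:
  assumes sa: "self_adjoint T" and "bounded_from_below T" and ess: "essential_spectrum T = {}"
    and ne: "op_space T \<noteq> {0}"
  shows ground_energy_le: "x \<in> op_dom T \<Longrightarrow> ground_energy T * (norm x)\<^sup>2 \<le> inner x (op_app T x)"
    and ground_energy_eigenvalue: "eigenspace T (complex_of_real (ground_energy T)) \<noteq> {0}"
proof -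
  define R where "R = {inner x (op_app T x) |x. x \<in> op_dom T \<and> norm x = 1}"
  define m where "m = Inf R"
  obtain c :: real where c: "\<forall>x\<in>op_dom T. complex_of_real (c * (norm x)\<^sup>2) \<le> cinner x (op_app T x)"
    using assms(2) by (auto simp: bounded_from_below_def)
  then have "c \<le> r" if "r \<in> R" for r
    using that by (fastforce simp: R_def less_eq_complex_def inner_eq_Re_cinner)
  then have bdd: "bdd_below R" by (auto simp: bdd_below_def)
  have scaled: "inner ((1 / norm x) *\<^sub>R x) (op_app T ((1 / norm x) *\<^sub>R x)) = inner x (op_app T x) / (norm x)\<^sup>2"
    if "x \<in> op_dom T" for x
    using clinear_on_scaleR[OF self_adjoint_clinear[OF sa] that, of "1 / norm x"]
    by (simp add: power2_eq_square)
  have inR: "inner x (op_app T x) / (norm x)\<^sup>2 \<in> R" if "x \<in> op_dom T" "x \<noteq> 0" for x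
    unfolding R_def using that scaled[OF that(1)] csubspace_scaleR[OF self_adjoint_dom(1)[OF sa] that(1)]
    by (intro CollectI exI[of _ "(1 / norm x) *\<^sub>R x"]) auto
  have "R \<noteq> {}"
    using densely_defined_nontrivial[OF _ ne self_adjoint_space(1)[OF sa]] sa inR
    by (metis empty_iff self_adjoint_def)
  have m: "m * (norm x)\<^sup>2 \<le> inner x (op_app T x)" if "x \<in> op_dom T" for x
  proof (cases "x = 0")
    case False
    then have "m \<le> inner x (op_app T x) / (norm x)\<^sup>2"
      unfolding m_def using inR[OF that] bdd by (simp add: cInf_lower)
    then show ?thesis using False by (simp add: pos_le_divide_eq)
  qed simp
  have "complex_of_real m \<in> spectrum T"
  proof (rule numerical_range_infimum_in_spectrum[OF sa m])
    fix e :: real assume "e > 0"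
    then have "\<exists>r\<in>R. r < m + e"
      unfolding m_def by (intro cInf_lessD[OF \<open>R \<noteq> {}\<close>]) simp
    then show "\<exists>x\<in>op_dom T. norm x = 1 \<and> inner x (op_app T x) < m + e"
      by (auto simp: R_def)
  qed
  then have "ground_energy T = m"
    unfolding ground_energy_def
    using resolvent_below_numerical_range[OF sa m]
    by (intro cInf_eq_minimum) (auto simp: spectrum_def not_less[symmetric])
  then show "x \<in> op_dom T \<Longrightarrow> ground_energy T * (norm x)\<^sup>2 \<le> inner x (op_app T x)"
    using m by simp
  have "complex_of_real m \<in> discrete_spectrum T"
    using \<open>complex_of_real m \<in> spectrum T\<close> ess by (auto simp: essential_spectrum_def)
  then show "eigenspace T (complex_of_real (ground_energy T)) \<noteq> {0}"
    using \<open>ground_energy T = m\<close> by (simp add: discrete_spectrum_def)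
qed

lemma shifted_inverse_props:
  assumes sa: "self_adjoint T"
    and m: "\<And>x. x \<in> op_dom T \<Longrightarrow> m * (norm x)\<^sup>2 \<le> inner x (op_app T x)" and "s > - m"
  shows shifted_inverse_dom: "y \<in> op_space T \<Longrightarrow> shifted_inverse T s y \<in> op_dom T"
    and shifted_inverse_right:
      "y \<in> op_space T \<Longrightarrow> op_app T (shifted_inverse T s y) + s *\<^sub>R shifted_inverse T s y = y"
    and shifted_inverse_left: "x \<in> op_dom T \<Longrightarrow> shifted_inverse T s (op_app T x + s *\<^sub>R x) = x"
proof -
  have "complex_of_real (- s) \<in> resolvent_set T"
    by (rule resolvent_below_numerical_range[OF sa m]) (use \<open>s > - m\<close> in auto)
  then have bij: "bij_betw (\<lambda>x. op_app T x + s *\<^sub>R x) (op_dom T) (op_space T)"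
    by (simp add: resolvent_set_def scaleC_minus_left scaleC_of_real)
  show "y \<in> op_space T \<Longrightarrow> shifted_inverse T s y \<in> op_dom T"
    unfolding shifted_inverse_def using bij by (metis bij_betw_imp_surj_on inv_into_into)
  show "y \<in> op_space T \<Longrightarrow> op_app T (shifted_inverse T s y) + s *\<^sub>R shifted_inverse T s y = y"
    unfolding shifted_inverse_def using bij bij_betw_inv_into_right by fastforce
  show "x \<in> op_dom T \<Longrightarrow> shifted_inverse T s (op_app T x + s *\<^sub>R x) = x"
    unfolding shifted_inverse_def using bij bij_betw_inv_into_left by fastforce
qed


section \<open>The Perron-Frobenius theorem for a self-dual cone\<close>

lemma self_dual_cone_facts:
  assumes "self_dual_cone \<HH> P"
  shows self_dual_cone_subset: "\<xi> \<in> P \<Longrightarrow> \<xi> \<in> \<HH>"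
    and self_dual_cone_closed: "closed P"
    and self_dual_cone_convex: "convex_cone P"
    and self_dual_cone_nonneg: "\<xi> \<in> P \<Longrightarrow> \<eta> \<in> P \<Longrightarrow> 0 \<le> cinner \<eta> \<xi>"
    and self_dual_coneI: "\<eta> \<in> \<HH> \<Longrightarrow> (\<And>\<xi>. \<xi> \<in> P \<Longrightarrow> 0 \<le> cinner \<eta> \<xi>) \<Longrightarrow> \<eta> \<in> P"
    and self_dual_cone_proper: "\<xi> \<in> P \<Longrightarrow> - \<xi> \<in> P \<Longrightarrow> \<xi> = 0"
proof -
  have hc: "hilbert_cone \<HH> P" and dual: "P = {\<eta> \<in> \<HH>. \<forall>\<xi>\<in>P. 0 \<le> cinner \<eta> \<xi>}"
    using assms by (auto simp: self_dual_cone_def)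
  show "\<xi> \<in> P \<Longrightarrow> \<xi> \<in> \<HH>" "closed P" "convex_cone P"
    using hc by (auto simp: hilbert_cone_def)
  show "\<xi> \<in> P \<Longrightarrow> \<eta> \<in> P \<Longrightarrow> 0 \<le> cinner \<eta> \<xi>"
    using dual by blast
  show "\<eta> \<in> \<HH> \<Longrightarrow> (\<And>\<xi>. \<xi> \<in> P \<Longrightarrow> 0 \<le> cinner \<eta> \<xi>) \<Longrightarrow> \<eta> \<in> P"
    using dual by blast
  have P0: "P \<inter> uminus ` P = {0}" using hc by (simp add: hilbert_cone_def)
  show "\<xi> = 0" if "\<xi> \<in> P" "- \<xi> \<in> P"
  proof -
    have "\<xi> \<in> uminus ` P" using that(2) by (metis imageI minus_minus)
    then show ?thesis using P0 that(1) by blast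
  qed
qed

text \<open>
  A self-dual cone induces a real structure on the Hilbert space: this is the real Hilbert space
  \<open>P - P\<close>, described by a closed condition.  The whole space is its complexification.
\<close>

definition cone_real_form :: "'h::chilbert_space set \<Rightarrow> 'h set \<Rightarrow> 'h set" where
  "cone_real_form \<HH> P = {v \<in> \<HH>. \<forall>\<xi>\<in>P. Im (cinner v \<xi>) = 0}"

lemma cone_real_form_subspace:
  assumes "csubspace \<HH>"
  shows "subspace (cone_real_form \<HH> P)"
  using assms unfolding subspace_def cone_real_form_def
  by (auto simp: csubspace_0 csubspace_add csubspace_scaleR cinner_simps)

lemma cone_real_form_closed:
  assumes "closed \<HH>"
  shows "closed (cone_real_form \<HH> P)"
  unfolding closed_sequential_limits
proof (intro allI impI, elim conjE)
  fix x l assume x: "\<forall>n. x n \<in> cone_real_form \<HH> P" and l: "x \<longlonglongrightarrow> l"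
  have "l \<in> \<HH>"
    using assms x l by (auto simp: cone_real_form_def intro: closed_sequentially)
  moreover have "Im (cinner l \<xi>) = 0" if "\<xi> \<in> P" for \<xi>
  proof (rule LIMSEQ_unique)
    show "(\<lambda>n. Im (cinner (x n) \<xi>)) \<longlonglongrightarrow> Im (cinner l \<xi>)"
      by (intro tendsto_Im tendsto_cinner l tendsto_const)
    show "(\<lambda>n. Im (cinner (x n) \<xi>)) \<longlonglongrightarrow> 0"
      using x that by (simp add: cone_real_form_def)
  qed
  ultimately show "l \<in> cone_real_form \<HH> P" by (simp add: cone_real_form_def)
qed

lemma cone_subset_real_form:
  assumes "self_dual_cone \<HH> P" "\<xi> \<in> P"
  shows "\<xi> \<in> cone_real_form \<HH> P"
  using self_dual_cone_subset[OF assms] self_dual_cone_nonneg[OF assms(1)] assms(2)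
  by (auto simp: cone_real_form_def less_eq_complex_def)

lemma cone_real_form_inter_imaginary:
  assumes "self_dual_cone \<HH> P" "v \<in> cone_real_form \<HH> P" "\<i> *\<^sub>C v \<in> cone_real_form \<HH> P"
    and "csubspace \<HH>"
  shows "v = 0"
proof (rule self_dual_cone_proper[OF assms(1)])
  have "cinner v \<xi> = 0" if "\<xi> \<in> P" for \<xi>
    using assms(2,3) that by (auto simp: cone_real_form_def cinner_simps complex_eq_iff)
  then show "v \<in> P" "- v \<in> P"
    using assms(2,4) by (auto simp: cone_real_form_def cinner_simps csubspace_minus
        intro!: self_dual_coneI[OF assms(1)])
qed

text \<open>
  The positive part \<open>a\<close> is the projection of \<open>v\<close> onto the cone.  By Moreau's theorem \<open>a - v\<close> has
  nonnegative real inner products with the cone; these inner products are real because \<open>v\<close> is in the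
  real form, so self-duality puts \<open>a - v\<close> into the cone.
\<close>

lemma cone_jordan_decomposition:
  assumes "self_dual_cone \<HH> P" "v \<in> cone_real_form \<HH> P" "csubspace \<HH>"
  obtains a b where "a \<in> P" "b \<in> P" "v = a - b" "inner a b = 0"
proof -
  obtain a where a: "a \<in> P" "inner (v - a) a = 0" "\<And>z. z \<in> P \<Longrightarrow> inner (v - a) z \<le> 0"
    using closed_convex_cone_projection[OF self_dual_cone_closed self_dual_cone_convex, OF assms(1) assms(1)]
    by metis
  define b where "b = a - v"
  have "a \<in> cone_real_form \<HH> P" using cone_subset_real_form[OF assms(1) a(1)] .
  then have b: "b \<in> cone_real_form \<HH> P"
    unfolding b_def using assms(2,3) by (simp add: cone_real_form_subspace subspace_diff)
  have "b \<in> P"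
  proof (rule self_dual_coneI[OF assms(1)])
    show "b \<in> \<HH>" using b by (simp add: cone_real_form_def)
    fix \<xi> assume "\<xi> \<in> P"
    then show "0 \<le> cinner b \<xi>"
      using b a(3)[of \<xi>] by (simp add: cone_real_form_def less_eq_complex_def b_def
          inner_eq_Re_cinner[symmetric] inner_diff_left)
  qed
  moreover have "inner a b = 0"
    using a(2) by (simp add: b_def inner_simps inner_commute)
  moreover have "v = a - b" by (simp add: b_def)
  ultimately show ?thesis using that a(1) by blast
qed

text \<open>
  What remains of \<open>x\<close> after the real orthogonal projection onto the real form has purely imaginary
  inner products with the cone, so it is \<open>\<i>\<close> times an element of the real form.
\<close>

lemma cone_complex_decomposition:
  assumes "csubspace \<HH>" "closed \<HH>" "self_dual_cone \<HH> P" "x \<in> \<HH>"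
  obtains u v where "u \<in> cone_real_form \<HH> P" "v \<in> cone_real_form \<HH> P" "x = u + \<i> *\<^sub>C v"
proof -
  obtain u where u: "u \<in> cone_real_form \<HH> P" "\<And>z. z \<in> cone_real_form \<HH> P \<Longrightarrow> inner (x - u) z = 0"
    using closed_subspace_projection[OF cone_real_form_closed[OF assms(2)] cone_real_form_subspace[OF assms(1)]]
    by metis
  define v where "v = (- \<i>) *\<^sub>C (x - u)"
  have "v \<in> cone_real_form \<HH> P"
  proof -
    have "v \<in> \<HH>"
      using u(1) assms by (simp add: v_def cone_real_form_def csubspace_diff csubspace_scaleC)
    then show ?thesis
      using u(2)[OF cone_subset_real_form[OF assms(3)]]
      by (simp add: cone_real_form_def v_def cinner_scaleC_left inner_eq_Re_cinner)
  qed
  moreover have "x = u + \<i> *\<^sub>C v" by (simp add: v_def scaleC_scaleC)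
  ultimately show ?thesis using that u(1) by blast
qed

text \<open>
  The hypothesis \<open>T_le\<close> says that no expectation of \<open>T\<close> exceeds \<open>1\<close>, the eigenvalue in question.  Let
  \<open>u = a - b\<close> be the Jordan decomposition of a fixed vector in the real form.  Replacing \<open>u\<close> by its
  absolute value \<open>a + b\<close> keeps the norm and cannot raise the expectation, maximal at \<open>u\<close>, which forces
  \<open>\<langle>a, T b\<rangle> = 0\<close>; since \<open>T\<close> improves positivity, \<open>a\<close> or \<open>b\<close> vanishes.  So nonzero fixed vectors of the real form are
  strictly positive up to sign.  Two of them can therefore not be orthogonal, and this yields simplicity.
\<close>

lemma perron_frobenius_cone:
  assumes cone: "self_dual_cone \<HH> P" and \<HH>: "csubspace \<HH>" "closed \<HH>"
    and T_in: "\<And>x. x \<in> \<HH> \<Longrightarrow> T x \<in> \<HH>" and T_lin: "clinear_on \<HH> T"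
    and T_sym: "\<And>x y. x \<in> \<HH> \<Longrightarrow> y \<in> \<HH> \<Longrightarrow> inner x (T y) = inner (T x) y"
    and T_le: "\<And>x. x \<in> \<HH> \<Longrightarrow> inner x (T x) \<le> (norm x)\<^sup>2"
    and improving: "positivity_improving P T"
    and x0: "x0 \<in> \<HH>" "T x0 = x0" "x0 \<noteq> 0"
  obtains \<psi> where "strictly_positive P \<psi>" "T \<psi> = \<psi>" "\<psi> \<noteq> 0"
    "\<And>x. x \<in> \<HH> \<Longrightarrow> T x = x \<Longrightarrow> \<exists>c. x = c *\<^sub>C \<psi>"
proof -
  let ?R = "cone_real_form \<HH> P"
  note P_sub = self_dual_cone_subset[OF cone]
  note R_sub = cone_real_form_subspace[OF \<HH>(1), of P]
  have R_in: "u \<in> \<HH>" if "u \<in> ?R" for u using that by (simp add: cone_real_form_def)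
  note T_add = clinear_on_add[OF T_lin] and T_diff = clinear_on_diff[OF T_lin \<HH>(1)]
    and T_C = clinear_on_scaleC[OF T_lin] and T_R = clinear_on_scaleR[OF T_lin]
  have T_P: "T \<xi> \<in> P" if "\<xi> \<in> P" for \<xi>
  proof (cases "\<xi> = 0")
    case True
    then show ?thesis using that T_R[OF P_sub[OF that], of 0] by simp
  next
    case False
    then show ?thesis using improving that by (auto simp: positivity_improving_def strictly_positive_def)
  qed
  have T_Re: "T u \<in> ?R" if u: "u \<in> ?R" for u
  proof -
    obtain a b where "a \<in> P" "b \<in> P" "u = a - b"
      using cone_jordan_decomposition[OF cone u \<HH>(1)] by metis
    then show ?thesis
      using T_P cone_subset_real_form[OF cone] R_sub by (simp add: T_diff P_sub subspace_diff)
  qed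
  \<comment> \<open>Real fixed vectors have a definite sign.\<close>
  have definite: "strictly_positive P u \<or> strictly_positive P (- u)"
    if u: "u \<in> ?R" "T u = u" "u \<noteq> 0" for u
  proof -
    obtain a b where ab: "a \<in> P" "b \<in> P" "u = a - b" "inner a b = 0"
      using cone_jordan_decomposition[OF cone u(1) \<HH>(1)] by metis
    note abH = P_sub[OF ab(1)] P_sub[OF ab(2)]
    have "inner (a + b) (T (a + b)) \<le> (norm (a + b))\<^sup>2"
      using abH \<HH> by (intro T_le) (simp add: csubspace_add)
    also have "\<dots> = inner u u"
      using ab(3,4) by (simp add: power2_norm_eq_inner inner_simps inner_commute)
    also have "\<dots> = inner (a - b) (T (a - b))" using u(2) ab(3) by simp
    finally have "inner a (T b) + inner b (T a) \<le> 0"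
      using abH by (simp add: T_add T_diff inner_simps)
    moreover have "inner b (T a) = inner a (T b)"
      using T_sym[OF abH] by (simp add: inner_commute)
    ultimately have "\<not> 0 < inner a (T b)" by simp
    moreover have "0 < inner a (T b)" if "a \<noteq> 0" "b \<noteq> 0"
      using improving that ab(1,2)
      by (auto simp: positivity_improving_def strictly_positive_def inner_eq_Re_cinner less_complex_def)
    ultimately consider "a = 0" | "b = 0" by blast
    then show ?thesis
    proof cases
      case 1
      then have "- u = b" "b \<noteq> 0" using ab(3) u(3) by auto
      moreover have "T (- u) = - u"
        using T_R[OF R_in[OF u(1)], of "-1"] u(2) by simp
      ultimately show ?thesis
        using improving ab(2) by (metis DiffI positivity_improving_def singletonD)
    next
      case 2
      then have "u = a" using ab(3) by simp
      then show ?thesis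
        using improving ab(1) u(2,3) by (metis DiffI positivity_improving_def singletonD)
    qed
  qed
  \<comment> \<open>Real and imaginary part of a fixed vector are fixed, as \<open>T\<close> preserves the real form.\<close>
  have parts: "\<exists>u\<in>?R. \<exists>v\<in>?R. x = u + \<i> *\<^sub>C v \<and> T u = u \<and> T v = v" if x: "x \<in> \<HH>" "T x = x" for x
  proof -
    obtain u v where uv: "u \<in> ?R" "v \<in> ?R" "x = u + \<i> *\<^sub>C v"
      using cone_complex_decomposition[OF \<HH> cone x(1)] by metis
    have iv: "\<i> *\<^sub>C v \<in> \<HH>" using uv(2) R_in \<HH> by (simp add: csubspace_scaleC)
    have *: "T u - u = \<i> *\<^sub>C (v - T v)"
      using x(2) R_in[OF uv(1)] R_in[OF uv(2)] iv
      by (simp add: uv(3) T_add T_C scaleC_diff_right algebra_simps)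
    have "v - T v \<in> ?R" "T u - u \<in> ?R"
      using uv T_Re R_sub by (simp_all add: subspace_diff)
    then have "v - T v = 0"
      using cone_real_form_inter_imaginary[OF cone _ _ \<HH>(1)] * by metis
    then show ?thesis using uv * by (intro bexI[of _ u] bexI[of _ v]) auto
  qed
  have "\<exists>u\<in>?R. T u = u \<and> u \<noteq> 0"
    using parts[OF x0(1,2)] x0(3) by (metis add.right_neutral scaleC_zero_right)
  then obtain u where u: "u \<in> ?R" "T u = u" "u \<noteq> 0" by blast
  define \<psi> where "\<psi> = (if strictly_positive P u then u else - u)"
  have \<psi>: "strictly_positive P \<psi>" "\<psi> \<noteq> 0" "\<psi> \<in> ?R"
    using definite[OF u] u R_sub by (auto simp: \<psi>_def subspace_neg)
  have "T (- u) = - u"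
    using T_R[OF R_in[OF u(1)], of "-1"] u(2) by simp
  then have T\<psi>: "T \<psi> = \<psi>" using u(2) by (simp add: \<psi>_def)
  have \<psi>P: "\<psi> \<in> P - {0}" using \<psi>(1,2) by (auto simp: strictly_positive_def)
  have real_multiple: "\<exists>t. w = t *\<^sub>R \<psi>" if w: "w \<in> ?R" "T w = w" for w
  proof -
    \<comment> \<open>Subtract the component along \<open>\<psi>\<close>: the rest is fixed, orthogonal to \<open>\<psi>\<close>, hence without sign.\<close>
    define t where "t = inner \<psi> w / (norm \<psi>)\<^sup>2"
    let ?d = "w - t *\<^sub>R \<psi>"
    have "?d \<in> ?R" using w \<psi>(3) R_sub by (simp add: subspace_diff subspace_scale)
    moreover have "T ?d = ?d"
      using w R_in \<psi>(3) T\<psi> \<HH> by (simp add: T_diff T_R csubspace_scaleR)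
    moreover have "inner \<psi> ?d = 0"
      using \<psi>(2) by (simp add: t_def inner_simps power2_norm_eq_inner)
    moreover have "0 < inner \<psi> v" if "strictly_positive P v" for v
      using that \<psi>P by (auto simp: strictly_positive_def inner_eq_Re_cinner less_complex_def)
    ultimately have "?d = 0"
      using definite[of ?d] by (metis inner_minus_right less_irrefl neg_0_equal_iff_equal)
    then show ?thesis by auto
  qed
  have "\<exists>c. x = c *\<^sub>C \<psi>" if x: "x \<in> \<HH>" "T x = x" for x
  proof -
    obtain u v where uv: "u \<in> ?R" "v \<in> ?R" "x = u + \<i> *\<^sub>C v" "T u = u" "T v = v"
      using parts[OF x] by blast
    then obtain s t where "u = s *\<^sub>R \<psi>" "v = t *\<^sub>R \<psi>" using real_multiple by metis
    then have "x = (complex_of_real s + \<i> * complex_of_real t) *\<^sub>C \<psi>"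
      using uv(3) by (simp add: scaleC_add_left scaleC_scaleC[symmetric] scaleC_of_real)
    then show ?thesis by blast
  qed
  then show ?thesis using that \<psi> T\<psi> by blast
qed

text \<open>
  The resolvent \<open>T = inverse (H + s)\<close> at \<open>s = 1 - E(H)\<close> is positivity improving and maps ground vectors to
  themselves, so that the ground eigenspace is the space of fixed vectors of \<open>T\<close>.
\<close>

lemma ground_state:
  assumes cone: "self_dual_cone \<HH> P" and H: "H \<in> A_plus \<HH> P" and ne: "\<HH> \<noteq> {0}"
  obtains \<psi> where "strictly_positive P \<psi>" "\<psi> \<noteq> 0"
    "eigenspace H (complex_of_real (ground_energy H)) = range (\<lambda>c. c *\<^sub>C \<psi>)"
proof -
  define g where "g = ground_energy H"
  define s where "s = 1 - g"
  define T where "T = shifted_inverse H s"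
  have [simp]: "op_space H = \<HH>" and sa: "self_adjoint H" and bd: "bounded_from_below H"
    and ess: "essential_spectrum H = {}" and imp: "positivity_improving P T"
    using H by (auto simp: A_plus_def T_def s_def g_def)
  have \<HH>: "csubspace \<HH>" "closed \<HH>" using self_adjoint_space[OF sa] by auto
  note dom = self_adjoint_dom[OF sa] and lin = self_adjoint_clinear[OF sa]
  have g: "g * (norm x)\<^sup>2 \<le> inner x (op_app H x)" if "x \<in> op_dom H" for x
    unfolding g_def using ground_energy_le[OF sa bd ess _ that] ne by simp
  have "s > - g" by (simp add: s_def)
  note inv = shifted_inverse_props[OF sa g \<open>s > - g\<close>, folded T_def, simplified]
  have T_eqI: "T x = z" if "z \<in> op_dom H" "op_app H z + s *\<^sub>R z = x" for x z
    using inv(3) that by blast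
  have T_add: "T (x + y) = T x + T y" if "x \<in> \<HH>" "y \<in> \<HH>" for x y
  proof (rule T_eqI)
    show "T x + T y \<in> op_dom H" using that inv(1) dom(1) by (simp add: csubspace_add)
    have "op_app H (T x + T y) + s *\<^sub>R (T x + T y)
        = (op_app H (T x) + s *\<^sub>R T x) + (op_app H (T y) + s *\<^sub>R T y)"
      using that inv(1) by (simp add: clinear_on_add[OF lin] scaleR_add_right)
    then show "op_app H (T x + T y) + s *\<^sub>R (T x + T y) = x + y"
      using that inv(2) by simp
  qed
  have T_C: "T (c *\<^sub>C x) = c *\<^sub>C T x" if "x \<in> \<HH>" for c x
  proof (rule T_eqI)
    show "c *\<^sub>C T x \<in> op_dom H" using that inv(1) dom(1) by (simp add: csubspace_scaleC)
    have "op_app H (c *\<^sub>C T x) + s *\<^sub>R (c *\<^sub>C T x) = c *\<^sub>C (op_app H (T x) + s *\<^sub>R T x)"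
      using that inv(1) by (simp add: clinear_on_scaleC[OF lin] scaleC_add_right scaleC_scaleR_right)
    then show "op_app H (c *\<^sub>C T x) + s *\<^sub>R (c *\<^sub>C T x) = c *\<^sub>C x"
      using that inv(2) by simp
  qed
  have sym: "inner x (T y) = inner (T x) y" if "x \<in> \<HH>" "y \<in> \<HH>" for x y
  proof -
    have "inner (T x) (op_app H (T y)) = inner (op_app H (T x)) (T y)"
      using self_adjoint_symmetric[OF sa inv(1) inv(1)] that by (simp add: inner_eq_Re_cinner)
    then have "inner (T x) (op_app H (T y) + s *\<^sub>R T y) = inner (op_app H (T x) + s *\<^sub>R T x) (T y)"
      by (simp add: inner_simps)
    then show ?thesis using inv(2) that by simp
  qed
  have le: "inner x (T x) \<le> (norm x)\<^sup>2" if "x \<in> \<HH>" for x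
  proof -
    have "(norm (T x))\<^sup>2 \<le> inner (T x) (op_app H (T x) + s *\<^sub>R T x)"
      using g[OF inv(1)[OF that]] by (simp add: s_def inner_simps power2_norm_eq_inner algebra_simps)
    then have "norm (T x) * norm (T x) \<le> norm (T x) * norm x"
      using inv(2)[OF that] norm_cauchy_schwarz[of "T x" x] by (simp add: power2_eq_square)
    then have "norm (T x) \<le> norm x"
      by (cases "T x = 0") auto
    then have "norm x * norm (T x) \<le> norm x * norm x" by (simp add: mult_left_mono)
    then show ?thesis using norm_cauchy_schwarz[of x "T x"] by (simp add: power2_eq_square)
  qed
  have eig: "x \<in> eigenspace H (complex_of_real g) \<longleftrightarrow> x \<in> \<HH> \<and> T x = x" for x
  proof
    assume "x \<in> eigenspace H (complex_of_real g)"
    then have x: "x \<in> op_dom H" "op_app H x = g *\<^sub>R x" by (auto simp: eigenspace_def scaleC_of_real)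
    then have "T x = x" by (intro T_eqI) (auto simp: s_def algebra_simps)
    then show "x \<in> \<HH> \<and> T x = x" using dom(2)[OF x(1)] by simp
  next
    assume x: "x \<in> \<HH> \<and> T x = x"
    then have "op_app H x + s *\<^sub>R x = x" using inv(2)[of x] by simp
    then have "op_app H x = g *\<^sub>R x" by (simp add: s_def algebra_simps)
    moreover have "x \<in> op_dom H" using inv(1)[of x] x by simp
    ultimately show "x \<in> eigenspace H (complex_of_real g)"
      by (simp add: eigenspace_def scaleC_of_real)
  qed
  have "eigenspace H (complex_of_real g) \<noteq> {0}"
    unfolding g_def using ground_energy_eigenvalue[OF sa bd ess] ne by simp
  moreover have "0 \<in> eigenspace H (complex_of_real g)"
    unfolding eig using \<HH> T_C[of 0 0] by (simp add: csubspace_0)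
  ultimately obtain x0 where x0: "x0 \<in> \<HH>" "T x0 = x0" "x0 \<noteq> 0" using eig by blast
  have T_in: "T x \<in> \<HH>" if "x \<in> \<HH>" for x using inv(1)[OF that] dom(2) by simp
  have "clinear_on \<HH> T" using T_add T_C by (simp add: clinear_on_def)
  from perron_frobenius_cone[OF cone \<HH> T_in this sym le imp x0]
  obtain \<psi> where \<psi>: "strictly_positive P \<psi>" "T \<psi> = \<psi>" "\<psi> \<noteq> 0"
    and all: "\<And>x. x \<in> \<HH> \<Longrightarrow> T x = x \<Longrightarrow> \<exists>c. x = c *\<^sub>C \<psi>"
    by metis
  have "\<psi> \<in> \<HH>" using \<psi>(1) self_dual_cone_subset[OF cone] by (simp add: strictly_positive_def)
  then have "eigenspace H (complex_of_real g) = range (\<lambda>c. c *\<^sub>C \<psi>)"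
    using all eig \<psi>(2) \<HH> by (auto simp: T_C csubspace_scaleC)
  then show ?thesis using that \<psi> by (simp add: g_def)
qed


section \<open>Strongly commuting operators and the good quantum number\<close>

text \<open>
  The difference quotients keep their norms, although \<open>W\<close> is linear on \<open>M\<close> only.
\<close>

lemma isometric_has_vector_derivative:
  assumes W: "isometric_on M W" and M: "csubspace M"
    and f: "\<And>t. f t \<in> M" and D: "D \<in> M" and der: "(f has_vector_derivative D) (at x)"
  shows "((\<lambda>t. W (f t)) has_vector_derivative W D) (at x)"
proof -
  have lin: "clinear_on M W" using W by (simp add: isometric_on_def)
  have "norm (W (f (x + h)) - W (f x) - h *\<^sub>R W D) = norm (f (x + h) - f x - h *\<^sub>R D)" for h
  proof -
    have "W (f (x + h)) - W (f x) - h *\<^sub>R W D = W (f (x + h) - f x - h *\<^sub>R D)"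
      using f D M by (simp add: clinear_on_diff[OF lin M] clinear_on_scaleR[OF lin]
          csubspace_diff csubspace_scaleR)
    then show ?thesis
      using f D M isometric_on_norm[OF W] by (simp add: csubspace_diff csubspace_scaleR)
  qed
  then show ?thesis
    using der unfolding has_vector_derivative_def has_derivative_at
    by (simp add: bounded_linear_scaleR_left)
qed

text \<open>
  Let \<open>U\<close> and \<open>V\<close> be the unitary groups of \<open>S\<close> and \<open>T\<close>.  As \<open>U s\<close> commutes with \<open>V t\<close>, the orbit of \<open>U s \<psi>\<close>
  under \<open>V\<close> has the derivative \<open>\<i> z (U s \<psi>)\<close> at \<open>0\<close>, so \<open>U s \<psi>\<close> is again an eigenvector of \<open>T\<close>.
  Hence \<open>s \<mapsto> U s \<psi>\<close> stays on the line through \<open>\<psi>\<close>, and so does its derivative \<open>\<i> S \<psi>\<close>.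
\<close>

lemma strongly_commute_simple_eigenvector:
  assumes comm: "strongly_commute S T" and sa: "self_adjoint T"
    and \<psi>: "\<psi> \<in> op_dom S" "\<psi> \<noteq> 0"
    and eig: "eigenspace T z = range (\<lambda>c. c *\<^sub>C \<psi>)"
  shows "\<exists>\<mu>. op_app S \<psi> = \<mu> *\<^sub>C \<psi>"
proof -
  obtain U V where sp: "op_space S = op_space T" and U: "unitary_group S U" and V: "unitary_group T V"
    and UV: "\<And>s t x. x \<in> op_space T \<Longrightarrow> U s (V t x) = V t (U s x)"
    using comm by (auto simp: strongly_commute_def)
  note sub = self_adjoint_space(1)[OF sa]
  have "1 *\<^sub>C \<psi> \<in> eigenspace T z" unfolding eig by blast
  then have \<psi>T: "\<psi> \<in> op_dom T" "op_app T \<psi> = z *\<^sub>C \<psi>" by (auto simp: eigenspace_def)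
  then have \<psi>_in: "\<psi> \<in> op_space T" using sa self_adjoint_dom(2) by blast
  have U_iso: "isometric_on (op_space T) (U s)" and UV_onto: "U s ` op_space T = op_space T"
    "V s ` op_space T = op_space T" for s
    using U V sp by (auto simp: unitary_group_def unitary_on_def)
  have U_in: "U s x \<in> op_space T" and V_in: "V s x \<in> op_space T" if "x \<in> op_space T" for s x
    using UV_onto[of s] that by blast+
  have "U s \<psi> \<in> eigenspace T z" for s
  proof -
    let ?D = "\<i> *\<^sub>C op_app T \<psi>"
    have "((\<lambda>t. V t \<psi>) has_vector_derivative ?D) (at 0)"
      using V \<psi>_in \<psi>T by (simp add: unitary_group_def)
    moreover have D: "?D \<in> op_space T"
      using \<psi>T \<psi>_in sub by (simp add: csubspace_scaleC)
    ultimately have "((\<lambda>t. U s (V t \<psi>)) has_vector_derivative U s ?D) (at 0)"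
      using isometric_has_vector_derivative[OF U_iso sub, of "\<lambda>t. V t \<psi>"] V_in[OF \<psi>_in] by simp
    then have "((\<lambda>t. V t (U s \<psi>)) has_vector_derivative U s ?D) (at 0)"
      by (simp add: UV \<psi>_in)
    then have dom: "U s \<psi> \<in> op_dom T" and "U s ?D = \<i> *\<^sub>C op_app T (U s \<psi>)"
      using V U_in[OF \<psi>_in] by (auto simp: unitary_group_def)
    moreover have "U s ?D = \<i> *\<^sub>C z *\<^sub>C U s \<psi>"
      using U_iso[of s] \<psi>_in sub
      by (simp add: \<psi>T isometric_on_def clinear_on_def csubspace_scaleC)
    ultimately have "inverse \<i> *\<^sub>C \<i> *\<^sub>C op_app T (U s \<psi>) = inverse \<i> *\<^sub>C \<i> *\<^sub>C z *\<^sub>C U s \<psi>"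
      by simp
    then have "op_app T (U s \<psi>) = z *\<^sub>C U s \<psi>" by (simp only: scaleC_cancel[OF complex_i_not_zero])
    then show ?thesis using dom by (simp add: eigenspace_def)
  qed
  then have line: "\<exists>c. U s \<psi> = c *\<^sub>C \<psi>" for s unfolding eig by blast
  let ?D = "\<i> *\<^sub>C op_app S \<psi>"
  have der: "((\<lambda>t. U t \<psi>) has_vector_derivative ?D) (at 0)"
    using U \<psi>_in sp \<psi>(1) by (simp add: unitary_group_def)
  define c where "c = cinner \<psi> ?D / cinner \<psi> \<psi>"
  \<comment> \<open>The component of the derivative orthogonal to the line.\<close>
  define y where "y = ?D - c *\<^sub>C \<psi>"
  have "cinner \<psi> y = 0" using \<psi>(2) by (simp add: y_def c_def cinner_simps)
  then have y: "cinner y \<psi> = 0" by (metis cinner_commute complex_cnj_zero)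
  have "((\<lambda>t. inner y (U t \<psi>)) has_vector_derivative inner y ?D) (at 0)"
    using bounded_linear_inner_right der by (rule bounded_linear.has_vector_derivative)
  moreover have "inner y (U t \<psi>) = 0" for t
    using line[of t] y by (auto simp: inner_eq_Re_cinner cinner_simps)
  ultimately have "((\<lambda>t. 0::real) has_vector_derivative inner y ?D) (at 0)" by simp
  then have "inner y ?D = 0"
    using vector_derivative_unique_at has_vector_derivative_const by blast
  moreover have "inner y (c *\<^sub>C \<psi>) = 0" using y by (simp add: inner_eq_Re_cinner cinner_simps)
  ultimately have "inner y y = 0" by (simp add: y_def inner_diff_right)
  then have "?D = c *\<^sub>C \<psi>" by (simp add: y_def)
  then have "inverse \<i> *\<^sub>C ?D = (inverse \<i> * c) *\<^sub>C \<psi>" by (simp only: scaleC_scaleC)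
  then show ?thesis by (metis scaleC_cancel complex_i_not_zero)
qed

text \<open>
  The action of the extension by zero is one and the same function for all Hilbert spaces that contain
  the reference space.  This allows one eigenvalue equation to be compared across different spaces.
\<close>

abbreviation zero_extension :: "'h::chilbert_space hop \<Rightarrow> 'h \<Rightarrow> 'h" where
  "zero_extension Q x \<equiv> op_app Q (orth_proj (op_space Q) x)"

definition symmetric_extension :: "'h::chilbert_space hop \<Rightarrow> bool" where
  "symmetric_extension Q \<longleftrightarrow>
     (\<forall>x y. cinner x (zero_extension Q y) = cinner (zero_extension Q x) y)"

lemma cinner_left_eqI: "(\<And>z. cinner z x = cinner z y) \<Longrightarrow> x = (y::'h::chilbert_space)"
  using cinner_same_eq_0[of "x - y"] by (simp add: cinner_diff_right)

lemma hamiltonians_cone: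
  assumes "H \<in> hamiltonians Q" "op_space Q \<noteq> {0}"
  obtains P where "self_dual_cone (op_space H) P" "H \<in> A_plus (op_space H) P"
    "self_adjoint H" "op_space H \<noteq> {0}" "closed_csubspace (op_space Q)"
proof -
  obtain \<HH> P where *: "closed_csubspace \<HH>" "closed_csubspace (op_space Q)" "op_space Q \<subseteq> \<HH>"
    "self_dual_cone \<HH> P" "H \<in> A_plus \<HH> P"
    using assms(1) by (auto simp: hamiltonians_def hamiltonians0_def)
  have "op_space H = \<HH>" "self_adjoint H" using *(5) by (auto simp: A_plus_def)
  moreover have "\<HH> \<noteq> {0}"
    using *(2,3) assms(2) csubspace_0 by (auto simp: closed_csubspace_def)
  ultimately show ?thesis using that * by blast
qed

text \<open>
  The good quantum number is defined through a choice of ground vector and of a cone.  Since the ground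
  eigenspace is a line, the eigenvalue equation holds for all ground vectors.
\<close>

lemma good_quantum_number_eigenvalue:
  assumes H: "H \<in> hamiltonians Q" and ne: "op_space Q \<noteq> {0}" and sym: "symmetric_extension Q"
    and x: "x \<in> eigenspace H (complex_of_real (ground_energy H))"
  shows "zero_extension Q x = good_quantum_number Q H *\<^sub>R x"
proof -
  note sym = sym[unfolded symmetric_extension_def, rule_format]
  obtain P where P: "self_dual_cone (op_space H) P" "H \<in> A_plus (op_space H) P"
    and sa: "self_adjoint H" and neH: "op_space H \<noteq> {0}"
    using hamiltonians_cone[OF H ne] by metis
  let ?E = "eigenspace H (complex_of_real (ground_energy H))"
  obtain \<psi> where \<psi>: "strictly_positive P \<psi>" "\<psi> \<noteq> 0" "?E = range (\<lambda>c. c *\<^sub>C \<psi>)"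
    using ground_state[OF P neH] by metis
  define \<phi> where "\<phi> = ground_vector H"
  have "1 *\<^sub>C \<psi> \<in> ?E" unfolding \<psi>(3) by blast
  then have "\<psi> \<in> ?E" by simp
  then have "\<exists>\<psi>. \<psi> \<in> ?E \<and> \<psi> \<noteq> 0 \<and>
     (\<exists>P. self_dual_cone (op_space H) P \<and> H \<in> A_plus (op_space H) P \<and> strictly_positive P \<psi>)"
    using \<psi>(1,2) P by blast
  then have "\<phi> \<in> ?E \<and> \<phi> \<noteq> 0 \<and>
     (\<exists>P. self_dual_cone (op_space H) P \<and> H \<in> A_plus (op_space H) P \<and> strictly_positive P \<phi>)"
    unfolding \<phi>_def ground_vector_def by (rule someI_ex)
  then have \<phi>: "\<phi> \<in> ?E" "\<phi> \<noteq> 0" by auto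
  then obtain a where a: "\<phi> = a *\<^sub>C \<psi>" "a \<noteq> 0" unfolding \<psi>(3) by force
  have line: "?E = range (\<lambda>c. c *\<^sub>C \<phi>)"
  proof -
    have "c *\<^sub>C \<psi> = (c / a) *\<^sub>C \<phi>" "c *\<^sub>C \<phi> = (c * a) *\<^sub>C \<psi>" for c
      using a by (simp_all add: scaleC_scaleC)
    then show ?thesis unfolding \<psi>(3) by (metis (no_types, lifting) image_cong rangeI subset_antisym image_subsetI)
  qed
  have "\<phi> \<in> op_dom (extend_by_zero Q (op_space H))"
    using \<phi>(1) self_adjoint_dom(2)[OF sa] by (simp add: eigenspace_def extend_by_zero_def)
  moreover have "strongly_commute (extend_by_zero Q (op_space H)) H"
    using H by (simp add: hamiltonians_def)
  ultimately obtain \<mu> where \<mu>: "zero_extension Q \<phi> = \<mu> *\<^sub>C \<phi>"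
    using strongly_commute_simple_eigenvector[OF _ sa _ \<phi>(2) line]
    by (metis extend_by_zero_def hop.select_convs(3))
  have "\<mu> * cinner \<phi> \<phi> = cnj \<mu> * cinner \<phi> \<phi>"
    using sym[of \<phi> \<phi>] by (simp add: \<mu> cinner_simps)
  then have "cnj \<mu> = \<mu>" using \<phi>(2) by simp
  then obtain m where m: "\<mu> = complex_of_real m" by (metis Reals_cases Reals_cnj_iff)
  have "good_quantum_number Q H = m"
    unfolding good_quantum_number_def \<phi>_def[symmetric]
    by (rule the_equality) (use \<mu> m \<phi>(2) in \<open>auto simp: extend_by_zero_def scaleC_of_real\<close>)
  then have \<phi>_eig: "zero_extension Q \<phi> = good_quantum_number Q H *\<^sub>R \<phi>"
    using \<mu> m by (simp add: scaleC_of_real)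
  obtain c where c: "x = c *\<^sub>C \<phi>" using x unfolding line by blast
  show ?thesis
  proof (rule cinner_left_eqI)
    fix z
    have "cinner z (zero_extension Q x) = c * cinner z (zero_extension Q \<phi>)"
      unfolding sym by (simp add: c cinner_simps)
    then show "cinner z (zero_extension Q x) = cinner z (good_quantum_number Q H *\<^sub>R x)"
      by (simp add: \<phi>_eig c cinner_simps)
  qed
qed

text \<open>
  The positive ground vector of \<open>H1\<close> is a nonzero element of \<open>P2\<close>, so it overlaps with the strictly
  positive ground vector of \<open>H2\<close>.
\<close>

lemma good_quantum_number_inherits:
  assumes inh: "inherits H1 P1 H2 P2" and H: "H1 \<in> hamiltonians Q" "H2 \<in> hamiltonians Q"
    and ne: "op_space Q \<noteq> {0}" and sym: "symmetric_extension Q"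
  shows "good_quantum_number Q H1 = good_quantum_number Q H2"
proof -
  have A: "H1 \<in> A_plus (op_space H1) P1" "H2 \<in> A_plus (op_space H2) P2"
    and cones: "self_dual_cone (op_space H1) P1" "self_dual_cone (op_space H2) P2"
    and "P1 \<subseteq> P2"
    using inh by (auto simp: inherits_def cone_inherits_def positivity_preserving_def)
  have ne': "op_space H1 \<noteq> {0}" "op_space H2 \<noteq> {0}"
    using hamiltonians_cone[OF H(1) ne] hamiltonians_cone[OF H(2) ne] by metis+
  obtain \<psi>1 where \<psi>1: "strictly_positive P1 \<psi>1" "\<psi>1 \<noteq> 0"
    "eigenspace H1 (complex_of_real (ground_energy H1)) = range (\<lambda>c. c *\<^sub>C \<psi>1)"
    using ground_state[OF cones(1) A(1) ne'(1)] by metis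
  obtain \<psi>2 where \<psi>2: "strictly_positive P2 \<psi>2" "\<psi>2 \<noteq> 0"
    "eigenspace H2 (complex_of_real (ground_energy H2)) = range (\<lambda>c. c *\<^sub>C \<psi>2)"
    using ground_state[OF cones(2) A(2) ne'(2)] by metis
  have "\<psi>1 \<in> P2 - {0}" using \<psi>1 \<open>P1 \<subseteq> P2\<close> by (auto simp: strictly_positive_def)
  then have "0 < cinner \<psi>1 \<psi>2" using \<psi>2(1) by (simp add: strictly_positive_def)
  then have nz: "cinner \<psi>1 \<psi>2 \<noteq> 0" by force
  have "1 *\<^sub>C \<psi>1 \<in> eigenspace H1 (complex_of_real (ground_energy H1))" unfolding \<psi>1(3) by blast
  then have e1: "zero_extension Q \<psi>1 = good_quantum_number Q H1 *\<^sub>R \<psi>1"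
    using good_quantum_number_eigenvalue[OF H(1) ne sym] by simp
  have "1 *\<^sub>C \<psi>2 \<in> eigenspace H2 (complex_of_real (ground_energy H2))" unfolding \<psi>2(3) by blast
  then have e2: "zero_extension Q \<psi>2 = good_quantum_number Q H2 *\<^sub>R \<psi>2"
    using good_quantum_number_eigenvalue[OF H(2) ne sym] by simp
  have "cinner \<psi>1 (zero_extension Q \<psi>2) = cinner (zero_extension Q \<psi>1) \<psi>2"
    using sym by (simp add: symmetric_extension_def)
  then show ?thesis using nz unfolding e1 e2 by (simp add: cinner_simps)
qed

text \<open>
  A Hamiltonian in the middle of the chain carries two cones, possibly unrelated.  This is harmless because
  the ground eigenspace, and with it the good quantum number, does not depend on the cone.
\<close>

lemma good_quantum_number_ham_arrow:
  assumes arr: "ham_arrow Q H K" and ne: "op_space Q \<noteq> {0}" and sym: "symmetric_extension Q"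
  shows "good_quantum_number Q H = good_quantum_number Q K"
proof -
  obtain N :: nat and Hs P P' where N: "2 \<le> N" and ends: "Hs 1 = H" "Hs N = K"
    and ham: "\<And>j. j \<in> {1..N} \<Longrightarrow> Hs j \<in> hamiltonians Q"
    and inh: "\<And>j. j \<in> {1..<N} \<Longrightarrow> inherits (Hs j) (P j) (Hs (j + 1)) (P' (j + 1))"
    using arr unfolding ham_arrow_def by blast
  have "1 \<le> N" using N by simp
  then have "good_quantum_number Q (Hs 1) = good_quantum_number Q (Hs N)"
  proof (induction rule: inc_induct)
    case (step j)
    have "good_quantum_number Q (Hs j) = good_quantum_number Q (Hs (j + 1))"
      by (rule good_quantum_number_inherits[OF inh ham ham ne sym]) (use step in auto)
    then show ?case using step by simp
  qed simp
  then show ?thesis unfolding ends .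
qed

text \<open>
  Both the class of \<open>H0\<close> and \<open>\<C>\<close> enter through representatives, which are linked to \<open>H0\<close> and \<open>H\<close> by
  arrows; the good quantum number is transported along all of them.
\<close>

lemma good_quantum_number_stability_class:
  assumes "\<C> \<in> stability_class Q H0" "H \<in> \<C>"
    and ne: "op_space Q \<noteq> {0}" and sym: "symmetric_extension Q"
  shows "good_quantum_number Q H = good_quantum_number Q H0"
proof -
  note inv = good_quantum_number_ham_arrow[OF _ ne sym]
  obtain G K where GK: "(H0, G) \<in> ham_equiv Q" "K \<in> \<C>" "ham_arrow Q G K"
    using assms(1) by (auto simp: stability_class_def class_arrow_def)
  obtain F where F: "\<C> = ham_equiv Q `` {F}"
    using assms(1) by (auto simp: stability_class_def ham_classes_def quotient_def)
  have "ham_arrow Q H0 G" "ham_arrow Q F K" "ham_arrow Q F H"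
    using GK assms(2) by (auto simp: F ham_equiv_def)
  then show ?thesis using inv[of H0 G] inv[of G K] inv[of F K] inv[of F H] GK(3) by simp
qed

lemma stability_class_representative:
  "\<C> \<in> stability_class Q H0 \<Longrightarrow> H0 \<in> hamiltonians Q"
  by (auto simp: stability_class_def class_arrow_def ham_equiv_def)

lemma symmetric_extension_embed_operator:
  assumes iso: "isometric_on M \<iota>" and cl: "closed_csubspace (\<iota> ` M)"
    and T: "\<And>v. v \<in> M \<Longrightarrow> T v \<in> M"
    and T_sym: "\<And>v w. v \<in> M \<Longrightarrow> w \<in> M \<Longrightarrow> cinner v (T w) = cinner (T v) w"
  shows "symmetric_extension (embed_operator \<iota> M T)"
proof -
  define p where "p x = inv_into M \<iota> (orth_proj (\<iota> ` M) x)" for x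
  have p: "p x \<in> M" "\<iota> (p x) = orth_proj (\<iota> ` M) x" for x
    using orth_proj_in[OF cl, of x] by (simp_all add: p_def inv_into_into f_inv_into_f)
  have left: "cinner x (\<iota> w) = cinner (p x) w" if "w \<in> M" for x w
    using cinner_orth_proj_left[OF cl, of "\<iota> w" x] that iso p[of x]
    by (metis imageI isometric_on_def)
  have right: "cinner (\<iota> w) x = cinner w (p x)" if "w \<in> M" for x w
    using left[OF that, of x] by (metis cinner_commute)
  show ?thesis
    unfolding symmetric_extension_def embed_operator_def hop.simps p_def[symmetric]
    using left right T T_sym p(1) by simp
qed

lemma isometric_on_inj:
  assumes "isometric_on M \<iota>" "csubspace M"
  shows "inj_on \<iota> M"
proof (rule inj_onI)
  fix x y assume "x \<in> M" "y \<in> M" "\<iota> x = \<iota> y"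
  moreover have "clinear_on M \<iota>" using assms(1) by (simp add: isometric_on_def)
  ultimately show "x = y"
    using isometric_on_norm[OF assms(1), of "x - y"] assms(2)
    by (simp add: clinear_on_diff csubspace_diff)
qed

text \<open>
  An explicit minimiser of the energy is a ground vector by the variational characterisation of the
  ground energy; its \<open>T\<close>-eigenvalue is the good quantum number.
\<close>

lemma good_quantum_number_embedded_minimizer:
  fixes \<iota> :: "'a::chilbert_space \<Rightarrow> 'h::chilbert_space"
  assumes iso: "isometric_on M \<iota>" and M: "csubspace M"
    and ham: "embed_operator \<iota> M K \<in> hamiltonians (embed_operator \<iota> M T)"
    and K: "\<And>w. w \<in> M \<Longrightarrow> K w \<in> M"
    and T: "\<And>w. w \<in> M \<Longrightarrow> T w \<in> M" "\<And>v w. v \<in> M \<Longrightarrow> w \<in> M \<Longrightarrow> cinner v (T w) = cinner (T v) w"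
    and v: "v \<in> M" "v \<noteq> 0" "K v = E *\<^sub>R v" "T v = m *\<^sub>R v"
    and min: "\<And>w. w \<in> M \<Longrightarrow> E * (norm w)\<^sup>2 \<le> inner w (K w)"
  shows "good_quantum_number (embed_operator \<iota> M T) (embed_operator \<iota> M K) = m"
proof -
  let ?H = "embed_operator \<iota> M K" and ?Q = "embed_operator \<iota> M T"
  have lin: "clinear_on M \<iota>" and inner\<iota>: "\<And>x y. x \<in> M \<Longrightarrow> y \<in> M \<Longrightarrow> inner (\<iota> x) (\<iota> y) = inner x y"
    using iso by (auto simp: isometric_on_def inner_eq_Re_cinner)
  have inv: "inv_into M \<iota> (\<iota> w) = w" if "w \<in> M" for w
    using isometric_on_inj[OF iso M] that by simp
  have \<iota>v: "\<iota> v \<noteq> 0" using isometric_on_norm[OF iso v(1)] v(2) by auto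
  have ne: "op_space ?Q \<noteq> {0}" using v(1) \<iota>v by (auto simp: embed_operator_def)
  obtain P where P: "?H \<in> A_plus (op_space ?H) P" and neH: "op_space ?H \<noteq> {0}"
    and "closed_csubspace (op_space ?Q)"
    using hamiltonians_cone[OF ham ne] by metis
  then have cl: "closed_csubspace (\<iota> ` M)" by (simp add: embed_operator_def)
  have sym: "symmetric_extension ?Q"
    using symmetric_extension_embed_operator[OF iso cl T] by blast
  have gs: "self_adjoint ?H" "bounded_from_below ?H" "essential_spectrum ?H = {}"
    using P by (auto simp: A_plus_def)
  let ?g = "ground_energy ?H"
  have "?g * (norm (\<iota> v))\<^sup>2 \<le> inner (\<iota> v) (op_app ?H (\<iota> v))"
    using ground_energy_le[OF gs neH] v(1) by (simp add: embed_operator_def)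
  also have "\<dots> = E * (norm (\<iota> v))\<^sup>2"
    using v K by (simp add: embed_operator_def inv inner\<iota> power2_norm_eq_inner clinear_on_scaleR[OF lin])
  finally have "?g \<le> E" using \<iota>v by simp
  moreover have "E \<le> ?g"
  proof -
    have "0 \<in> eigenspace ?H (complex_of_real ?g)"
      using self_adjoint_dom(1)[OF gs(1)] clinear_on_scaleR[OF self_adjoint_clinear[OF gs(1)], of 0 0]
      by (simp add: eigenspace_def csubspace_0)
    then obtain x where x: "x \<in> op_dom ?H" "op_app ?H x = ?g *\<^sub>R x" "x \<noteq> 0"
      using ground_energy_eigenvalue[OF gs neH] by (auto simp: eigenspace_def scaleC_of_real)
    then obtain w where w: "w \<in> M" "x = \<iota> w" by (auto simp: embed_operator_def)
    have "E * (norm x)\<^sup>2 \<le> inner x (op_app ?H x)"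
      using min[OF w(1)] w K isometric_on_norm[OF iso w(1)]
      by (simp add: embed_operator_def inv inner\<iota>)
    also have "\<dots> = ?g * (norm x)\<^sup>2" using x(2) by (simp add: power2_norm_eq_inner)
    finally show ?thesis using x(3) by simp
  qed
  ultimately have "?g = E" by simp
  then have "\<iota> v \<in> eigenspace ?H (complex_of_real ?g)"
    using v by (simp add: eigenspace_def embed_operator_def inv scaleC_of_real clinear_on_scaleR[OF lin])
  then have "zero_extension ?Q (\<iota> v) = good_quantum_number ?Q ?H *\<^sub>R \<iota> v"
    using good_quantum_number_eigenvalue[OF ham ne sym] by blast
  moreover have "zero_extension ?Q (\<iota> v) = m *\<^sub>R \<iota> v"
    using v cl by (simp add: embed_operator_def inv orth_proj_id closed_csubspace_def
        clinear_on_scaleR[OF lin])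
  ultimately show ?thesis using \<iota>v by simp
qed


section \<open>Exchanging two spins\<close>

definition exchange :: "'x \<Rightarrow> 'x \<Rightarrow> ('x \<Rightarrow> 2) \<Rightarrow> ('x \<Rightarrow> 2)" where
  "exchange x y \<sigma> = \<sigma>(x := \<sigma> y, y := \<sigma> x)"

lemma exchange_exchange [simp]: "exchange x y (exchange x y \<sigma>) = \<sigma>"
  by (auto simp: exchange_def fun_eq_iff)

lemma exchange_commute: "exchange x y = exchange y x"
  by (auto simp: exchange_def fun_eq_iff)

lemma exchange_equal: "\<sigma> x = \<sigma> y \<Longrightarrow> exchange x y \<sigma> = \<sigma>"
  by (auto simp: exchange_def fun_eq_iff)

lemma sum_exchange: "(\<Sum>\<sigma>\<in>UNIV. f (exchange x y \<sigma>)) = (\<Sum>\<sigma>\<in>UNIV. f (\<sigma> :: 'x::finite \<Rightarrow> 2))"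
  by (rule sum.reindex_bij_witness[of _ "exchange x y" "exchange x y"]) auto

lemma spin_half_cases: obtains "(s::2) = 1" | "s = 2"
  using exhaust_2 by blast

lemma spin_half_not_up: "(s::2) \<noteq> 1 \<longleftrightarrow> s = 2"
  using exhaust_2[of s] by auto

text \<open>
  The identity of Dirac: on two spins one half, \<open>S\<^sub>x \<cdot> S\<^sub>y\<close> is half the exchange operator minus a quarter.
  For \<open>x = y\<close> the value is \<open>3/4\<close>, which the last summand accounts for.
\<close>

lemma spin_pair_dot:
  "(\<Sum>j\<in>UNIV. spin x j (spin y j v) $ \<sigma>) =
     v $ exchange x y \<sigma> / 2 - v $ \<sigma> / 4 + (if x = y then v $ \<sigma> / 2 else 0)"
proof (cases "x = y")
  case True
  then show ?thesis
    by (cases "\<sigma> y" rule: spin_half_cases)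
      (simp_all add: spin_def pauli_def sum_3 sum_2 exchange_def fun_upd_idem)
next
  case False
  then have twist: "\<sigma>(x := s, y := t) = \<sigma>(y := t, x := s)" for s t by (simp add: fun_upd_twist)
  show ?thesis
    by (cases "\<sigma> x" rule: spin_half_cases; cases "\<sigma> y" rule: spin_half_cases)
      (use False in \<open>simp_all add: spin_def pauli_def sum_3 sum_2 exchange_def field_simps twist
         fun_upd_idem\<close>)
qed

lemma linear_spin: "linear (spin x j)"
  by (rule linearI)
    (auto simp: spin_def vec_eq_iff sum.distrib distrib_left scaleR_sum_right)

lemma spin_dot_exchange:
  "spin_dot X Y v $ \<sigma> =
     (\<Sum>x\<in>X. \<Sum>y\<in>Y. v $ exchange x y \<sigma> / 2 - v $ \<sigma> / 4 + (if x = y then v $ \<sigma> / 2 else 0))"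
proof -
  have "spin_dot X Y v = (\<Sum>j\<in>UNIV. \<Sum>x\<in>X. \<Sum>y\<in>Y. spin x j (spin y j v))"
    by (simp add: spin_dot_def spin_sum_def linear_sum[OF linear_spin])
  also have "\<dots> = (\<Sum>x\<in>X. \<Sum>y\<in>Y. \<Sum>j\<in>UNIV. spin x j (spin y j v))"
    by (subst sum.swap, rule sum.cong[OF refl], rule sum.swap)
  finally have "spin_dot X Y v = (\<Sum>x\<in>X. \<Sum>y\<in>Y. \<Sum>j\<in>UNIV. spin x j (spin y j v))" .
  then show ?thesis by (simp only: sum_component spin_pair_dot)
qed

lemma spin_dot_commute: "spin_dot X Y = spin_dot Y X"
  by (rule ext, unfold vec_eq_iff spin_dot_exchange, rule allI, subst sum.swap)
    (simp add: exchange_commute eq_commute)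

text \<open>
  The exchange operators are symmetric because they permute the basis by an involution.
\<close>

lemma spin_dot_symmetric: "cinner v (spin_dot X Y w) = cinner (spin_dot X Y v) (w :: 'x::finite spin_space)"
proof -
  have swap: "(\<Sum>\<sigma>\<in>UNIV. cnj (v $ \<sigma>) * w $ exchange x y \<sigma>) = (\<Sum>\<sigma>\<in>UNIV. cnj (v $ exchange x y \<sigma>) * w $ \<sigma>)" for x y
    using sum_exchange[of "\<lambda>\<sigma>. cnj (v $ exchange x y \<sigma>) * w $ \<sigma>" x y] by simp
  have "cinner v (spin_dot X Y w) = (\<Sum>x\<in>X. \<Sum>y\<in>Y. \<Sum>\<sigma>\<in>UNIV. cnj (v $ \<sigma>) * w $ exchange x y \<sigma> / 2
      - cnj (v $ \<sigma>) * w $ \<sigma> / 4 + (if x = y then cnj (v $ \<sigma>) * w $ \<sigma> / 2 else 0))"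
    unfolding cinner_vec_def cinner_complex_def spin_dot_exchange sum_distrib_left
    by (subst sum.swap, rule sum.cong[OF refl], subst sum.swap, intro sum.cong refl)
      (simp add: algebra_simps)
  also have "\<dots> = (\<Sum>x\<in>X. \<Sum>y\<in>Y. \<Sum>\<sigma>\<in>UNIV. cnj (v $ exchange x y \<sigma>) * w $ \<sigma> / 2
      - cnj (v $ \<sigma>) * w $ \<sigma> / 4 + (if x = y then cnj (v $ \<sigma>) * w $ \<sigma> / 2 else 0))"
    using swap by (simp add: sum.distrib sum_subtractf flip: sum_divide_distrib)
  also have "\<dots> = cinner (spin_dot X Y v) w"
    unfolding cinner_vec_def cinner_complex_def spin_dot_exchange cnj_sum sum_distrib_right
    by (subst (2) sum.swap, rule sum.cong[OF refl], subst (2) sum.swap, intro sum.cong refl)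
      (simp add: algebra_simps)
  finally show ?thesis .
qed

definition up_count :: "'x::finite set \<Rightarrow> ('x \<Rightarrow> 2) \<Rightarrow> nat" where
  "up_count X \<sigma> = card {x \<in> X. \<sigma> x = 1}"

lemma down_count: "card {x \<in> X. \<sigma> x = 2} = card X - up_count X \<sigma>" for X :: "'x::finite set"
proof -
  have "{x \<in> X. \<sigma> x = 2} = X - {x \<in> X. \<sigma> x = 1}"
    by (auto simp: spin_half_not_up)
  then show ?thesis by (simp add: up_count_def card_Diff_subset)
qed

lemma up_count_le: "up_count X \<sigma> \<le> card X" for X :: "'x::finite set"
  unfolding up_count_def by (rule card_mono) auto

text \<open>
  The subtraction in the first claim does not truncate, since \<open>x\<close> itself is counted in \<open>up_count X \<sigma>\<close>.
\<close>

lemma up_count_exchange_across: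
  assumes "x \<in> X" "y \<notin> X"
  shows "\<sigma> x = 1 \<Longrightarrow> \<sigma> y = 2 \<Longrightarrow> up_count X (exchange x y \<sigma>) = up_count X \<sigma> - 1"
    and "\<sigma> x = 2 \<Longrightarrow> \<sigma> y = 1 \<Longrightarrow> up_count X (exchange x y \<sigma>) = up_count X \<sigma> + 1"
proof -
  assume s: "\<sigma> x = 1" "\<sigma> y = 2"
  have "{a \<in> X. exchange x y \<sigma> a = 1} = {a \<in> X. \<sigma> a = 1} - {x}"
    using assms s by (auto simp: exchange_def)
  then show "up_count X (exchange x y \<sigma>) = up_count X \<sigma> - 1"
    using assms s by (simp add: up_count_def)
next
  assume s: "\<sigma> x = 2" "\<sigma> y = 1"
  have "{a \<in> X. exchange x y \<sigma> a = 1} = insert x {a \<in> X. \<sigma> a = 1}"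
    using assms s by (auto simp: exchange_def)
  then show "up_count X (exchange x y \<sigma>) = up_count X \<sigma> + 1"
    using assms s by (simp add: up_count_def)
qed

lemma up_count_exchange_same_side:
  assumes "x \<in> X \<longleftrightarrow> y \<in> X"
  shows "up_count X (exchange x y \<sigma>) = up_count X \<sigma>"
proof -
  have swap: "up_count X (exchange x y \<sigma>) = up_count X \<sigma>"
    if "x \<in> X" "y \<in> X" "\<sigma> x = 1" "\<sigma> y = 2" for x y
  proof -
    have "{a \<in> X. exchange x y \<sigma> a = 1} = insert y ({a \<in> X. \<sigma> a = 1} - {x})"
      using that by (auto simp: exchange_def)
    moreover have "card (insert y ({a \<in> X. \<sigma> a = 1} - {x})) = Suc (card ({a \<in> X. \<sigma> a = 1} - {x}))"
      using that by (intro card_insert_disjoint) auto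
    ultimately show ?thesis
      using that card_Suc_Diff1[of "{a \<in> X. \<sigma> a = 1}" x] by (simp add: up_count_def)
  qed
  show ?thesis
  proof (cases "x \<in> X")
    case True
    then have "y \<in> X" using assms by simp
    then show ?thesis
      using True swap[of x y] swap[of y x] exchange_equal[of \<sigma> x y]
      by (cases "\<sigma> x" rule: spin_half_cases; cases "\<sigma> y" rule: spin_half_cases)
        (simp_all add: exchange_commute[of y x])
  next
    case False
    then have "{a \<in> X. exchange x y \<sigma> a = 1} = {a \<in> X. \<sigma> a = 1}"
      using assms by (auto simp: exchange_def)
    then show ?thesis by (simp add: up_count_def)
  qed
qed

text \<open>
  The configurations of zero magnetization; doubling avoids halving an odd number of sites.
\<close>

definition balanced :: "('x::finite \<Rightarrow> 2) \<Rightarrow> bool" where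
  "balanced \<sigma> \<longleftrightarrow> 2 * up_count UNIV \<sigma> = CARD('x)"

lemma balanced_exchange [simp]: "balanced (exchange x y \<sigma>) \<longleftrightarrow> balanced \<sigma>"
  by (simp add: balanced_def up_count_exchange_same_side)

lemma zero_magnetization_iff:
  "v \<in> zero_magnetization \<longleftrightarrow> (\<forall>\<sigma>. \<not> balanced \<sigma> \<longrightarrow> v $ \<sigma> = 0)"
  for v :: "'x::finite spin_space"
proof -
  have S: "spin_sum UNIV 3 v $ \<sigma> = (of_nat (up_count UNIV \<sigma>) - of_nat (CARD('x) - up_count UNIV \<sigma>)) * v $ \<sigma> / 2"
    for \<sigma> :: "'x \<Rightarrow> 2"
  proof -
    have "spin x 3 v $ \<sigma> = (if \<sigma> x = 1 then v $ \<sigma> / 2 else 0) - (if \<sigma> x = 2 then v $ \<sigma> / 2 else 0)" for x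
      by (cases "\<sigma> x" rule: spin_half_cases) (simp_all add: spin_def pauli_def sum_2 fun_upd_idem)
    then have "spin_sum UNIV 3 v $ \<sigma> =
        (\<Sum>x\<in>UNIV. if \<sigma> x = 1 then v $ \<sigma> / 2 else 0) - (\<Sum>x\<in>UNIV. if \<sigma> x = 2 then v $ \<sigma> / 2 else 0)"
      by (simp add: spin_sum_def sum_subtractf)
    also have "\<dots> = of_nat (card {x. \<sigma> x = 1}) * (v $ \<sigma> / 2) - of_nat (card {x. \<sigma> x = 2}) * (v $ \<sigma> / 2)"
      by (simp add: sum.If_cases)
    finally show ?thesis
      using down_count[of UNIV \<sigma>] by (simp add: up_count_def algebra_simps)
  qed
  have D: "(of_nat (up_count UNIV \<sigma>) - of_nat (CARD('x) - up_count UNIV \<sigma>) :: complex) = 0 \<longleftrightarrow> balanced \<sigma>"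
    for \<sigma> :: "'x \<Rightarrow> 2"
    using up_count_le[of UNIV \<sigma>] unfolding balanced_def right_minus_eq of_nat_eq_iff by linarith
  have "spin_sum UNIV 3 v $ \<sigma> = 0 \<longleftrightarrow> balanced \<sigma> \<or> v $ \<sigma> = 0" for \<sigma>
    unfolding S divide_eq_0_iff mult_eq_0_iff D by simp
  then show ?thesis
    by (auto simp: zero_magnetization_def vec_eq_iff)
qed

lemma zero_magnetization_csubspace: "csubspace zero_magnetization"
  by (auto simp: csubspace_def zero_magnetization_iff scaleC_vec_def scaleC_complex_def)

lemma spin_dot_zero_magnetization:
  "v \<in> zero_magnetization \<Longrightarrow> spin_dot X Y v \<in> zero_magnetization"
  by (auto simp: zero_magnetization_iff spin_dot_exchange intro!: sum.neutral)

lemma balanced_exists: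
  assumes "even CARD('x::finite)"
  obtains \<sigma> :: "'x::finite \<Rightarrow> 2" where "balanced \<sigma>"
proof -
  obtain U :: "'x set" where "card U = CARD('x) div 2"
    using obtain_subset_with_card_n[of "CARD('x) div 2" "UNIV :: 'x set"] by auto
  then have "up_count UNIV (\<lambda>x. if x \<in> U then 1 else 2) = CARD('x) div 2"
    by (simp add: up_count_def)
  then show ?thesis using that assms by (auto simp: balanced_def)
qed

section \<open>The ground state of the Marshall-Lieb-Mattis Hamiltonian\<close>

text \<open>
  For \<open>|B| \<le> |A|\<close>, spins \<open>|A|/2\<close> and \<open>|B|/2\<close> couple to the smallest possible total spin, \<open>(|A| - |B|)/2\<close>, with
  Clebsch-Gordan coefficients that consist of a single term.  Dividing by the norms of the symmetric
  states of the sublattices turns them, up to a common factor, into these weights.  The sign is the Marshall sign: at zero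
  magnetization the numbers of up spins in \<open>A\<close> and in \<open>B\<close> have a constant sum, so either may be used in
  the exponent, up to a global sign.
\<close>

definition mlm_weight :: "'x::finite set \<Rightarrow> ('x \<Rightarrow> 2) \<Rightarrow> real" where
  "mlm_weight A \<sigma> = (- 1) ^ up_count A \<sigma> * fact (up_count A \<sigma>) * fact (card A - up_count A \<sigma>)"

lemma mlm_weight_nonzero [simp]: "mlm_weight A \<sigma> \<noteq> 0"
  by (simp add: mlm_weight_def)

lemma mlm_weight_exchange_same_side:
  "(x \<in> A \<longleftrightarrow> y \<in> A) \<Longrightarrow> mlm_weight A (exchange x y \<sigma>) = mlm_weight A \<sigma>"
  by (simp add: mlm_weight_def up_count_exchange_same_side)

lemma mlm_weight_exchange_across:
  assumes "x \<in> A" "y \<notin> A"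
  shows "exchange x y \<sigma> = \<sigma> \<or> mlm_weight A (exchange x y \<sigma>) / mlm_weight A \<sigma> < 0"
proof -
  have pos: "up_count A \<sigma> > 0" if "\<sigma> x = 1"
    using that assms(1) by (auto simp: up_count_def card_gt_0_iff)
  show ?thesis
    using up_count_exchange_across[OF assms, of \<sigma>] pos exchange_equal[of \<sigma> x y]
    by (cases "\<sigma> x" rule: spin_half_cases; cases "\<sigma> y" rule: spin_half_cases;
        cases "up_count A \<sigma>") (auto simp: mlm_weight_def divide_simps zero_less_mult_iff mult_less_0_iff)
qed

lemma sum_spin_cases:
  "(\<Sum>x\<in>X. if \<sigma> x = (1::2) then a else b) = real (up_count X \<sigma>) * a + real (card X - up_count X \<sigma>) * b"
  for X :: "'x::finite set"
proof -
  have "X \<inter> - {x. \<sigma> x = 1} = {x \<in> X. \<sigma> x = 2}" by (auto simp: spin_half_not_up)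
  then show ?thesis
    using down_count[of X \<sigma>] by (simp add: sum.If_cases up_count_def Int_def)
qed

text \<open>
  Let \<open>n\<close> and \<open>k\<close> be the numbers of up spins in \<open>A\<close> and \<open>B\<close>, and \<open>\<alpha>\<close> and \<open>\<beta>\<close> the sizes of \<open>A\<close> and \<open>B\<close>.  Pairs with
  equal spins leave the weight unchanged; \<open>n (\<beta> - k)\<close> pairs lower \<open>n\<close> and \<open>(\<alpha> - n) k\<close> pairs raise it.  The
  factorials cancel these multiplicities, and the total factor is
  \<open>n k + (\<alpha> - n) (\<beta> - k) - (\<alpha> - n + 1) (\<beta> - k) - (n + 1) k = - \<beta>\<close>.
  At the ends \<open>n = 0\<close> and \<open>n = \<alpha>\<close> there is no factor to cancel.  There \<open>2 (n + k) = \<alpha> + \<beta>\<close> and \<open>\<beta> \<le> \<alpha>\<close>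
  force \<open>k = \<beta>\<close> and \<open>k = 0\<close> respectively, so that the terms vanish on both sides.
\<close>

lemma mlm_weight_sum_across:
  fixes A B :: "'x::finite set"
  assumes AB: "A \<union> B = UNIV" "A \<inter> B = {}" and le: "card B \<le> card A" and bal: "balanced \<sigma>"
  shows "(\<Sum>x\<in>A. \<Sum>y\<in>B. mlm_weight A (exchange x y \<sigma>)) = - real (card B) * mlm_weight A \<sigma>"
proof -
  define n k \<alpha> \<beta> where "n = up_count A \<sigma>" "k = up_count B \<sigma>" "\<alpha> = card A" "\<beta> = card B"
  note defs = this
  have "n \<le> \<alpha>" "k \<le> \<beta>" by (simp_all add: defs up_count_le)
  have "{x. \<sigma> x = 1} = {x \<in> A. \<sigma> x = 1} \<union> {x \<in> B. \<sigma> x = 1}" using AB by auto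
  then have "up_count UNIV \<sigma> = n + k"
    unfolding defs up_count_def using AB by (simp add: card_Un_disjoint disjoint_iff)
  moreover have "CARD('x) = \<alpha> + \<beta>"
    using card_Un_disjoint[of A B] AB by (simp add: defs)
  ultimately have nk: "2 * (n + k) = \<alpha> + \<beta>" using bal by (simp add: balanced_def)
  define w :: "nat \<Rightarrow> real" where "w m = (- 1) ^ m * fact m * fact (\<alpha> - m)" for m
  have w: "mlm_weight A \<sigma> = w n" by (simp add: mlm_weight_def w_def defs)
  have weight: "mlm_weight A (exchange x y \<sigma>) =
      (if \<sigma> x = 1 then if \<sigma> y = 1 then w n else w (n - 1) else if \<sigma> y = 1 then w (n + 1) else w n)"
    if xy: "x \<in> A" "y \<in> B" for x y
  proof -
    have "y \<notin> A" using xy AB by auto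
    note up = up_count_exchange_across[OF xy(1) this, of \<sigma>]
    show ?thesis
      using up exchange_equal[of \<sigma> x y]
      by (cases "\<sigma> x" rule: spin_half_cases; cases "\<sigma> y" rule: spin_half_cases)
        (simp_all add: mlm_weight_def w_def defs)
  qed
  have "(\<Sum>x\<in>A. \<Sum>y\<in>B. mlm_weight A (exchange x y \<sigma>)) =
      (\<Sum>x\<in>A. if \<sigma> x = 1 then \<Sum>y\<in>B. if \<sigma> y = 1 then w n else w (n - 1)
               else \<Sum>y\<in>B. if \<sigma> y = 1 then w (n + 1) else w n)"
    by (intro sum.cong refl) (auto simp: weight intro!: sum.cong)
  also have "\<dots> = real n * (real k * w n + real (\<beta> - k) * w (n - 1))
      + real (\<alpha> - n) * (real k * w (n + 1) + real (\<beta> - k) * w n)"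
    unfolding sum_spin_cases defs ..
  also have "\<dots> = real n * real k * w n + real (\<alpha> - n) * real (\<beta> - k) * w n
      + real (\<beta> - k) * (real n * w (n - 1)) + real k * (real (\<alpha> - n) * w (n + 1))"
    by (simp add: algebra_simps)
  also have "real (\<beta> - k) * (real n * w (n - 1)) = - real (\<beta> - k) * (real \<alpha> - real n + 1) * w n"
  proof (cases n)
    case 0
    then have "\<beta> - k = 0" using nk le by (simp add: defs)
    then show ?thesis by simp
  next
    case (Suc m)
    then have "\<alpha> - m = Suc (\<alpha> - n)" using \<open>n \<le> \<alpha>\<close> by simp
    then show ?thesis using Suc \<open>n \<le> \<alpha>\<close> by (simp add: w_def of_nat_diff algebra_simps)
  qed
  also have "real k * (real (\<alpha> - n) * w (n + 1)) = - real k * (real n + 1) * w n"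
  proof (cases "n = \<alpha>")
    case True
    then have "k = 0" using nk le by (simp add: defs)
    then show ?thesis by simp
  next
    case False
    then obtain m where m: "\<alpha> - n = Suc m" "\<alpha> - (n + 1) = m" using \<open>n \<le> \<alpha>\<close>
      by (metis Suc_diff_Suc Suc_eq_plus1 le_neq_implies_less)
    then show ?thesis by (simp add: w_def algebra_simps)
  qed
  also have "real n * real k * w n + real (\<alpha> - n) * real (\<beta> - k) * w n
      + - real (\<beta> - k) * (real \<alpha> - real n + 1) * w n + - real k * (real n + 1) * w n = - real \<beta> * w n"
    using \<open>n \<le> \<alpha>\<close> \<open>k \<le> \<beta>\<close> by (simp add: of_nat_diff algebra_simps)
  finally show ?thesis by (simp add: w defs)
qed

definition mlm_state :: "'x::finite set \<Rightarrow> 'x spin_space" where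
  "mlm_state A = (\<chi> \<sigma>. if balanced \<sigma> then complex_of_real (mlm_weight A \<sigma>) else 0)"

lemma mlm_state_zero_magnetization: "mlm_state A \<in> zero_magnetization"
  by (simp add: zero_magnetization_iff mlm_state_def)

lemma mlm_state_nonzero:
  assumes "even CARD('x::finite)"
  shows "mlm_state (A :: 'x::finite set) \<noteq> 0"
proof -
  obtain \<sigma> :: "'x \<Rightarrow> 2" where "balanced \<sigma>" using balanced_exists[OF assms] .
  then have "mlm_state A $ \<sigma> \<noteq> 0" by (simp add: mlm_state_def)
  then show ?thesis by force
qed

lemma mlm_state_component:
  "mlm_state A $ \<sigma> = (if balanced \<sigma> then complex_of_real (mlm_weight A \<sigma>) else 0)"
  by (simp add: mlm_state_def)

lemma spin_dot_mlm_state: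
  "spin_dot X Y (mlm_state A) $ \<sigma> = (if balanced \<sigma> then
     complex_of_real ((\<Sum>x\<in>X. \<Sum>y\<in>Y. mlm_weight A (exchange x y \<sigma>)) / 2
       - real (card X) * real (card Y) * mlm_weight A \<sigma> / 4
       + real (card (X \<inter> Y)) * mlm_weight A \<sigma> / 2) else 0)"
  for X Y :: "'x::finite set"
proof -
  have "(\<Sum>x\<in>X. \<Sum>y\<in>Y. if x = y then c else 0) = of_nat (card (X \<inter> Y)) * c" for c :: complex
    by (simp add: sum.If_cases Int_commute)
  then show ?thesis
    by (simp add: spin_dot_exchange mlm_state_component sum.distrib sum_subtractf
        flip: sum_divide_distrib)
qed

context
  fixes A B :: "'x::finite set"
  assumes AB: "A \<union> B = UNIV" "A \<inter> B = {}" and le: "card B \<le> card A"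
begin

lemma mlm_state_energy:
  "spin_dot A B (mlm_state A)
     = (- real (card B) / 2 - real (card A) * real (card B) / 4) *\<^sub>R mlm_state A"
  unfolding vec_eq_iff
  by (auto simp: spin_dot_mlm_state AB(2) mlm_weight_sum_across[OF AB le] mlm_state_component
      scaleR_conv_of_real[where 'a = complex] algebra_simps)

text \<open>
  The squared total spin sums the exchanges over all ordered pairs of sites.  Pairs within a sublattice
  fix the weight, and each of the two families of pairs across contributes \<open>- |B|\<close> times it.
\<close>

lemma mlm_state_total_spin:
  defines "s \<equiv> (real (card A) - real (card B)) / 2"
  shows "total_spin_squared (mlm_state A) = (s * (s + 1)) *\<^sub>R mlm_state A"
proof -
  let ?\<alpha> = "real (card A)" and ?\<beta> = "real (card B)"
  have total: "(\<Sum>x\<in>UNIV. \<Sum>y\<in>UNIV. mlm_weight A (exchange x y \<sigma>))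
      = (?\<alpha>\<^sup>2 + ?\<beta>\<^sup>2 - 2 * ?\<beta>) * mlm_weight A \<sigma>" if bal: "balanced \<sigma>" for \<sigma>
  proof -
    let ?f = "\<lambda>x y. mlm_weight A (exchange x y \<sigma>)"
    have split: "(\<Sum>x\<in>UNIV. g x) = (\<Sum>x\<in>A. g x) + (\<Sum>x\<in>B. g x)" for g :: "'x \<Rightarrow> real"
      using sum.union_disjoint[of A B g] AB by simp
    have AA: "(\<Sum>x\<in>A. \<Sum>y\<in>A. ?f x y) = ?\<alpha>\<^sup>2 * mlm_weight A \<sigma>"
      by (simp add: mlm_weight_exchange_same_side power2_eq_square)
    have "(\<Sum>x\<in>B. \<Sum>y\<in>B. ?f x y) = (\<Sum>x\<in>B. \<Sum>y\<in>B. mlm_weight A \<sigma>)"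
      using AB by (intro sum.cong refl mlm_weight_exchange_same_side) auto
    then have BB: "(\<Sum>x\<in>B. \<Sum>y\<in>B. ?f x y) = ?\<beta>\<^sup>2 * mlm_weight A \<sigma>"
      by (simp add: power2_eq_square)
    have "(\<Sum>x\<in>B. \<Sum>y\<in>A. ?f x y) = (\<Sum>y\<in>A. \<Sum>x\<in>B. ?f y x)"
      by (subst sum.swap) (simp add: exchange_commute)
    then show ?thesis
      using mlm_weight_sum_across[OF AB le bal] AA BB
      by (simp add: split sum.distrib algebra_simps)
  qed
  have card: "real CARD('x) = ?\<alpha> + ?\<beta>"
    using card_Un_disjoint[of A B] AB by simp
  show ?thesis
    unfolding vec_eq_iff total_spin_squared_def
    by (auto simp: spin_dot_mlm_state total card s_def mlm_state_component scaleR_conv_of_real[where 'a = complex]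
        power2_eq_square field_simps)
qed

text \<open>
  A ground state representation with respect to the weights.  For a pair across the sublattices let \<open>r\<close>
  be the ratio of the weights of the exchanged and the original configuration.  If the exchange is
  nontrivial then \<open>r < 0\<close>, and by the arithmetic-geometric mean inequality the product of the two
  amplitudes of \<open>\<phi>\<close> is bounded below in terms of their squares, weighted with \<open>r\<close> and \<open>1/r\<close>.  After summation
  over all configurations both halves agree, and the sum of the ratios over all pairs is \<open>- |B|\<close>.
\<close>

lemma mlm_energy_lower_bound:
  assumes \<phi>: "\<phi> \<in> zero_magnetization"
  shows "(- real (card B) / 2 - real (card A) * real (card B) / 4) * (norm \<phi>)\<^sup>2
           \<le> inner \<phi> (spin_dot A B \<phi>)"
proof -
  define r where "r x y \<sigma> = mlm_weight A (exchange x y \<sigma>) / mlm_weight A \<sigma>" for x y \<sigma>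
  define c where "c x y \<sigma> = Re (cnj (\<phi> $ \<sigma>) * \<phi> $ exchange x y \<sigma>)" for x y \<sigma>
  have norm: "(norm \<phi>)\<^sup>2 = (\<Sum>\<sigma>\<in>UNIV. (cmod (\<phi> $ \<sigma>))\<^sup>2)"
    by (simp add: norm_vec_def L2_set_def sum_nonneg)
  have pair: "(\<Sum>\<sigma>\<in>UNIV. (cmod (\<phi> $ \<sigma>))\<^sup>2 * r x y \<sigma>) \<le> (\<Sum>\<sigma>\<in>UNIV. c x y \<sigma>)"
    if xy: "x \<in> A" "y \<in> B" for x y
  proof -
    let ?p = "\<lambda>\<sigma>. (cmod (\<phi> $ \<sigma>))\<^sup>2"
    have yA: "y \<notin> A" using xy AB by auto
    have "?p \<sigma> * r x y \<sigma> / 2 + ?p (exchange x y \<sigma>) * r x y (exchange x y \<sigma>) / 2 \<le> c x y \<sigma>" for \<sigma>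
    proof (cases "exchange x y \<sigma> = \<sigma>")
      case True
      then show ?thesis
        by (simp add: r_def c_def complex_norm_square[symmetric] mult.commute[of "cnj _"] flip: of_real_power)
    next
      case False
      define q a b where "q = - r x y \<sigma>" "a = cmod (\<phi> $ \<sigma>)" "b = cmod (\<phi> $ exchange x y \<sigma>)"
      note qab = this
      have "q > 0" using mlm_weight_exchange_across[OF xy(1) yA, of \<sigma>] False by (simp add: qab r_def)
      have "0 \<le> (q * a - b)\<^sup>2" by simp
      then have "2 * (q * (a * b)) \<le> q * (q * a\<^sup>2) + b\<^sup>2"
        by (simp add: power2_eq_square algebra_simps)
      then have "a * b \<le> a\<^sup>2 * q / 2 + b\<^sup>2 / q / 2"
        using \<open>q > 0\<close> by (simp add: field_simps)
      moreover have "- c x y \<sigma> \<le> a * b"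
        using abs_Re_le_cmod[of "cnj (\<phi> $ \<sigma>) * \<phi> $ exchange x y \<sigma>"]
        by (simp add: c_def qab norm_mult)
      moreover have "r x y (exchange x y \<sigma>) = - (1 / q)" by (simp add: qab r_def)
      ultimately show ?thesis by (simp add: qab(2,3)[symmetric]) (simp add: qab(1))
    qed
    then have "(\<Sum>\<sigma>\<in>UNIV. ?p \<sigma> * r x y \<sigma> / 2 + ?p (exchange x y \<sigma>) * r x y (exchange x y \<sigma>) / 2)
        \<le> (\<Sum>\<sigma>\<in>UNIV. c x y \<sigma>)" by (intro sum_mono)
    also have "(\<Sum>\<sigma>\<in>UNIV. ?p \<sigma> * r x y \<sigma> / 2 + ?p (exchange x y \<sigma>) * r x y (exchange x y \<sigma>) / 2)
        = (\<Sum>\<sigma>\<in>UNIV. ?p \<sigma> * r x y \<sigma>)"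
      using sum_exchange[of "\<lambda>\<sigma>. ?p \<sigma> * r x y \<sigma>" x y]
      by (simp add: sum.distrib flip: sum_divide_distrib)
    finally show ?thesis .
  qed
  have sum_r: "(\<Sum>x\<in>A. \<Sum>y\<in>B. r x y \<sigma>) = - real (card B)" if "balanced \<sigma>" for \<sigma>
    using mlm_weight_sum_across[OF AB le that] by (simp add: r_def flip: sum_divide_distrib)
  have "- real (card B) * (cmod (\<phi> $ \<sigma>))\<^sup>2 = (cmod (\<phi> $ \<sigma>))\<^sup>2 * (\<Sum>x\<in>A. \<Sum>y\<in>B. r x y \<sigma>)" for \<sigma>
    using \<phi> by (cases "balanced \<sigma>") (simp_all add: sum_r zero_magnetization_iff)
  then have "- real (card B) * (norm \<phi>)\<^sup>2
      = (\<Sum>\<sigma>\<in>UNIV. (cmod (\<phi> $ \<sigma>))\<^sup>2 * (\<Sum>x\<in>A. \<Sum>y\<in>B. r x y \<sigma>))"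
    unfolding norm by (subst sum_distrib_left) (rule sum.cong[OF refl])
  also have "\<dots> = (\<Sum>x\<in>A. \<Sum>y\<in>B. \<Sum>\<sigma>\<in>UNIV. (cmod (\<phi> $ \<sigma>))\<^sup>2 * r x y \<sigma>)"
    unfolding sum_distrib_left
    by (subst sum.swap, rule sum.cong[OF refl], rule sum.swap)
  also have "\<dots> \<le> (\<Sum>x\<in>A. \<Sum>y\<in>B. \<Sum>\<sigma>\<in>UNIV. c x y \<sigma>)"
    by (intro sum_mono pair)
  finally have bound: "- real (card B) * (norm \<phi>)\<^sup>2 \<le> (\<Sum>x\<in>A. \<Sum>y\<in>B. \<Sum>\<sigma>\<in>UNIV. c x y \<sigma>)" .
  have "inner \<phi> (spin_dot A B \<phi>) = (\<Sum>\<sigma>\<in>UNIV. \<Sum>x\<in>A. \<Sum>y\<in>B. c x y \<sigma> / 2 - (cmod (\<phi> $ \<sigma>))\<^sup>2 / 4)"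
  proof -
    have *: "Re (cnj (\<phi> $ \<sigma>) * (\<phi> $ exchange x y \<sigma> / 2 - \<phi> $ \<sigma> / 4 + (if x = y then \<phi> $ \<sigma> / 2 else 0)))
        = c x y \<sigma> / 2 - (cmod (\<phi> $ \<sigma>))\<^sup>2 / 4" if "x \<in> A" "y \<in> B" for x y \<sigma>
    proof -
      have "x \<noteq> y" using that AB by auto
      moreover have "cnj (\<phi> $ \<sigma>) * \<phi> $ \<sigma> = complex_of_real ((cmod (\<phi> $ \<sigma>))\<^sup>2)"
        by (metis complex_norm_square mult.commute)
      ultimately show ?thesis by (simp add: c_def right_diff_distrib)
    qed
    show ?thesis
      unfolding inner_eq_Re_cinner cinner_vec_def cinner_complex_def spin_dot_exchange sum_distrib_left Re_sum
      by (intro sum.cong refl *)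
  qed
  also have "\<dots> = (\<Sum>\<sigma>\<in>UNIV. \<Sum>x\<in>A. \<Sum>y\<in>B. c x y \<sigma>) / 2 - real (card A) * real (card B) / 4 * (norm \<phi>)\<^sup>2"
    unfolding norm by (simp add: sum_subtractf sum_distrib_left mult.assoc flip: sum_divide_distrib)
  also have "(\<Sum>\<sigma>\<in>UNIV. \<Sum>x\<in>A. \<Sum>y\<in>B. c x y \<sigma>) = (\<Sum>x\<in>A. \<Sum>y\<in>B. \<Sum>\<sigma>\<in>UNIV. c x y \<sigma>)"
    by (subst sum.swap, rule sum.cong[OF refl], rule sum.swap)
  finally show ?thesis using bound by (simp add: algebra_simps)
qed

end

lemma good_quantum_number_mlm:
  fixes A B :: "'x::finite set" and \<iota> :: "'x spin_space \<Rightarrow> 'h::chilbert_space"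
  assumes AB: "A \<union> B = UNIV" "A \<inter> B = {}" and le: "card B \<le> card A" and "even CARD('x)"
    and "isometric_on zero_magnetization \<iota>"
    and "embed_operator \<iota> zero_magnetization (spin_dot A B)
      \<in> hamiltonians (embed_operator \<iota> zero_magnetization total_spin_squared)"
  defines "s \<equiv> (real (card A) - real (card B)) / 2"
  shows "good_quantum_number (embed_operator \<iota> zero_magnetization total_spin_squared)
      (embed_operator \<iota> zero_magnetization (spin_dot A B)) = s * (s + 1)"
  by (rule good_quantum_number_embedded_minimizer[OF assms(5) zero_magnetization_csubspace assms(6)
        _ _ _ mlm_state_zero_magnetization[of A] mlm_state_nonzero[OF assms(4)] mlm_state_energy[OF AB le]
        mlm_state_total_spin[OF AB le, folded s_def] mlm_energy_lower_bound[OF AB le]])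
    (simp_all add: spin_dot_zero_magnetization spin_dot_symmetric total_spin_squared_def)

theorem theorem5p1:
  fixes A B :: "'x::finite set"
    and \<iota> :: "'x spin_space \<Rightarrow> 'h::chilbert_space"
    and \<C> :: "'h hop set" and H :: "'h hop" and S_star :: real
  assumes "A \<union> B = UNIV" and "A \<inter> B = {}" and "even CARD('x)"
    and "isometric_on zero_magnetization \<iota>"
    and "\<C> \<in> stability_class
           (embed_operator \<iota> zero_magnetization total_spin_squared)
           (embed_operator \<iota> zero_magnetization (spin_dot A B))"
    and "H \<in> \<C>"
    and "S_star = \<bar>real (card A) - real (card B)\<bar> / 2"
  shows "good_quantum_number (embed_operator \<iota> zero_magnetization total_spin_squared) H
           = S_star * (S_star + 1)"
proof -
  let ?Q = "embed_operator \<iota> zero_magnetization total_spin_squared"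
  let ?H0 = "embed_operator \<iota> zero_magnetization (spin_dot A B)"
  have ham: "?H0 \<in> hamiltonians ?Q"
    using assms(5) by (rule stability_class_representative)
  have "norm (\<iota> (mlm_state A)) \<noteq> 0"
    using isometric_on_norm[OF assms(4) mlm_state_zero_magnetization] mlm_state_nonzero[OF assms(3), of A]
    by simp
  then have ne: "op_space ?Q \<noteq> {0}"
    using mlm_state_zero_magnetization[of A] by (auto simp: embed_operator_def)
  have "closed_csubspace (\<iota> ` zero_magnetization)"
    using hamiltonians_cone[OF ham ne] by (metis embed_operator_def hop.select_convs(1))
  then have sym: "symmetric_extension ?Q"
    using symmetric_extension_embed_operator[OF assms(4)]
    by (simp add: total_spin_squared_def spin_dot_zero_magnetization spin_dot_symmetric)
  have "good_quantum_number ?Q H = good_quantum_number ?Q ?H0"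
    using good_quantum_number_stability_class[OF assms(5,6) ne sym] .
  also have "\<dots> = S_star * (S_star + 1)"
  proof (cases "card B \<le> card A")
    case True
    then show ?thesis
      using good_quantum_number_mlm[OF assms(1,2) True assms(3,4) ham] by (simp add: assms(7))
  next
    case False
    then show ?thesis
      using good_quantum_number_mlm[of B A \<iota>] assms(1-4) ham
      by (simp add: assms(7) Un_commute Int_commute spin_dot_commute[of B A])
  qed
  finally show ?thesis .
qed

end
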